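(* Let $R$ be a commutative ring, $(A,q_A)$ a quaternion algebra over $R$ (a composition algebra of rank $4$), $n\ge1$, and $V=A\oplus H(R^n)$ with quadratic form $q(\alpha,v,w)=\alpha\overline{\alpha}+v\cdot w^{\intercal}$. Let $\phi:\mathrm{Cl}(V)\to M_{2^{n+1}}(A)$ be the $R$-algebra homomorphism extending the linear map $(\alpha,v,w)\mapsto\begin{pmatrix}0&Z_n(\alpha,v,w)\\\overline{Z_n(\alpha,v,w)}&0\end{pmatrix}$ (which squares to $q(\alpha,v,w)$). Then $\phi$ is injective, and $\mathrm{Cl}(V)$ and $M_{2^{n+1}}(A)$ have the same rank as free $R$-modules.
   Context: A composition algebra over $R$ is a unital $R$-algebra $A$, free of finite rank, containing $R$ via $1\mapsto1$, with a non-degenerate quadratic form $q_A$ satisfying $q_A(xy)=q_A(x)q_A(y)$; it has an involution $\alpha\mapsto\overline{\alpha}$ with $\alpha\overline{\alpha}=\overline{\alpha}\alpha=q_A(\alpha)$. A quadratic form is non-degenerate if its polar bilinear form $\langle x,y\rangle=q(x+y)-q(x)-q(y)$ satisfies: $\langle x,y\rangle=0$ for all $y$ implies $x=0$. $H(R^n)=R^n\oplus(R^n)^*$. For $v=(a_1,\dots,a_n)$, $w=(b_1,\dots,b_n)$: $Z_1(\alpha,v,w)=\begin{pmatrix}a_1&\alpha\\-\overline{\alpha}&b_1\end{pmatrix}$, $\overline{Z_1}=\begin{pmatrix}b_1&-\alpha\\\overline{\alpha}&a_1\end{pmatrix}$, and for $i>1$, $Z_i=\begin{pmatrix}a_i&Z_{i-1}\\-\overline{Z_{i-1}}&b_i\end{pmatrix}$,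 $\overline{Z_i}=\begin{pmatrix}b_i&-Z_{i-1}\\\overline{Z_{i-1}}&a_i\end{pmatrix}$ (scalars denote scalar multiples of the identity), so $Z_n\in M_{2^n}(A)$. $\mathrm{Cl}(V)$ is the Clifford algebra of $(V,q)$. *)

theory Defs
  imports Main
begin

text \<open>R is a type of class comm_ring_1, A a type of class ring_1 (associative unital ring);
  emb : R -> A is the structure map making A an R-algebra (image central, 1 maps to 1,
  injective, i.e. A contains R). Scalar multiplication r.x is emb r * x.\<close>

definition polarA :: "('a::ring_1 \<Rightarrow> 'r::comm_ring_1) \<Rightarrow> 'a \<Rightarrow> 'a \<Rightarrow> 'r" where
  "polarA qA x y = qA (x + y) - qA x - qA y"

definition conjA :: "('r::comm_ring_1 \<Rightarrow> 'a::ring_1) \<Rightarrow> ('a \<Rightarrow> 'r) \<Rightarrow> 'a \<Rightarrow> 'a" where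
  "conjA emb qA x = emb (polarA qA x 1) - x"

definition composition_algebra ::
  "('r::comm_ring_1 \<Rightarrow> 'a::ring_1) \<Rightarrow> ('a \<Rightarrow> 'r) \<Rightarrow> nat \<Rightarrow> bool" where
  "composition_algebra emb qA m \<longleftrightarrow>
     emb 1 = 1 \<and> (\<forall>r s. emb (r + s) = emb r + emb s) \<and> (\<forall>r s. emb (r * s) = emb r * emb s)
   \<and> inj emb \<and> (\<forall>r x. emb r * x = x * emb r)
   \<and> (\<exists>b::nat \<Rightarrow> 'a. (\<forall>x. \<exists>c. x = (\<Sum>i<m. emb (c i) * b i))
          \<and> (\<forall>c. (\<Sum>i<m. emb (c i) * b i) = 0 \<longrightarrow> (\<forall>i<m. c i = 0)))
   \<and> (\<forall>r x. qA (emb r * x) = r ^ 2 * qA x)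
   \<and> (\<forall>x y z. polarA qA (x + y) z = polarA qA x z + polarA qA y z)
   \<and> (\<forall>r x y. polarA qA (emb r * x) y = r * polarA qA x y)
   \<and> (\<forall>x. (\<forall>y. polarA qA x y = 0) \<longrightarrow> x = 0)
   \<and> (\<forall>x y. qA (x * y) = qA x * qA y)"

definition quaternion_algebra :: "('r::comm_ring_1 \<Rightarrow> 'a::ring_1) \<Rightarrow> ('a \<Rightarrow> 'r) \<Rightarrow> bool" where
  "quaternion_algebra emb qA \<longleftrightarrow> composition_algebra emb qA 4"

text \<open>An element (alpha, v, w) of V: v, w : nat -> R with coordinates a_i = v (i-1),
  b_i = w (i-1) for i = 1..n; coordinates k >= n are required to vanish.\<close>

type_synonym ('a, 'r) vec = "'a \<times> (nat \<Rightarrow> 'r) \<times> (nat \<Rightarrow> 'r)"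

definition Vset :: "nat \<Rightarrow> ('a, 'r::zero) vec set" where
  "Vset n = {(\<alpha>, v, w). \<forall>k\<ge>n. v k = 0 \<and> w k = 0}"

definition vadd :: "('a::plus, 'r::plus) vec \<Rightarrow> ('a, 'r) vec \<Rightarrow> ('a, 'r) vec" where
  "vadd x y = (case x of (\<alpha>, v, w) \<Rightarrow> case y of (\<beta>, v', w') \<Rightarrow>
      (\<alpha> + \<beta>, \<lambda>k. v k + v' k, \<lambda>k. w k + w' k))"

definition vsmul :: "('r \<Rightarrow> 'a::times) \<Rightarrow> 'r::times \<Rightarrow> ('a, 'r) vec \<Rightarrow> ('a, 'r) vec" where
  "vsmul emb r x = (case x of (\<alpha>, v, w) \<Rightarrow> (emb r * \<alpha>, \<lambda>k. r * v k, \<lambda>k. r * w k))"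

text \<open>q(alpha, v, w) = alpha * conj alpha + v . w^T, with alpha * conj alpha = q_A(alpha).\<close>
definition qV :: "('a \<Rightarrow> 'r::comm_ring_1) \<Rightarrow> nat \<Rightarrow> ('a, 'r) vec \<Rightarrow> 'r" where
  "qV qA n x = (case x of (\<alpha>, v, w) \<Rightarrow> qA \<alpha> + (\<Sum>k<n. v k * w k))"

definition fa_elem :: "'x set \<Rightarrow> ('x list \<Rightarrow> 'r::zero) \<Rightarrow> bool" where
  "fa_elem X t \<longleftrightarrow> finite {u. t u \<noteq> 0} \<and> (\<forall>u. t u \<noteq> 0 \<longrightarrow> set u \<subseteq> X)"

definition fa_add :: "('x list \<Rightarrow> 'r::plus) \<Rightarrow> ('x list \<Rightarrow> 'r) \<Rightarrow> 'x list \<Rightarrow> 'r" where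
  "fa_add s t = (\<lambda>u. s u + t u)"

definition fa_diff :: "('x list \<Rightarrow> 'r::minus) \<Rightarrow> ('x list \<Rightarrow> 'r) \<Rightarrow> 'x list \<Rightarrow> 'r" where
  "fa_diff s t = (\<lambda>u. s u - t u)"

definition fa_smul :: "'r::times \<Rightarrow> ('x list \<Rightarrow> 'r) \<Rightarrow> 'x list \<Rightarrow> 'r" where
  "fa_smul r t = (\<lambda>u. r * t u)"

definition fa_mul :: "('x list \<Rightarrow> 'r::comm_ring_1) \<Rightarrow> ('x list \<Rightarrow> 'r) \<Rightarrow> 'x list \<Rightarrow> 'r" where
  "fa_mul s t = (\<lambda>u. \<Sum>k\<le>length u. s (take k u) * t (drop k u))"

definition fa_word :: "'x list \<Rightarrow> 'x list \<Rightarrow> 'r::{zero,one}" where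
  "fa_word u = (\<lambda>u'. if u' = u then 1 else 0)"

definition fa_const :: "'r::zero \<Rightarrow> 'x list \<Rightarrow> 'r" where
  "fa_const r = (\<lambda>u. if u = [] then r else 0)"

inductive_set fa_ideal :: "'x set \<Rightarrow> ('x list \<Rightarrow> 'r::comm_ring_1) set \<Rightarrow> ('x list \<Rightarrow> 'r) set"
  for X G where
  zero: "(\<lambda>_. 0) \<in> fa_ideal X G"
| gen: "g \<in> G \<Longrightarrow> g \<in> fa_ideal X G"
| add: "a \<in> fa_ideal X G \<Longrightarrow> b \<in> fa_ideal X G \<Longrightarrow> fa_add a b \<in> fa_ideal X G"
| lmul: "a \<in> fa_ideal X G \<Longrightarrow> fa_elem X c \<Longrightarrow> fa_mul c a \<in> fa_ideal X G"
| rmul: "a \<in> fa_ideal X G \<Longrightarrow> fa_elem X c \<Longrightarrow> fa_mul a c \<in> fa_ideal X G"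

text \<open>Relations defining Cl(V): linearity of the generating map V -> Cl(V) and x^2 = q(x).
  Cl(V) is the free algebra on the set V modulo cl_ideal.\<close>
definition cl_gens :: "('r::comm_ring_1 \<Rightarrow> 'a::ring_1) \<Rightarrow> ('a \<Rightarrow> 'r) \<Rightarrow> nat
    \<Rightarrow> (('a, 'r) vec list \<Rightarrow> 'r) set" where
  "cl_gens emb qA n =
     {fa_diff (fa_word [vadd x y]) (fa_add (fa_word [x]) (fa_word [y])) | x y. x \<in> Vset n \<and> y \<in> Vset n}
   \<union> {fa_diff (fa_word [vsmul emb r x]) (fa_smul r (fa_word [x])) | r x. x \<in> Vset n}
   \<union> {fa_diff (fa_word [x, x]) (fa_const (qV qA n x)) | x. x \<in> Vset n}"

definition cl_ideal :: "('r::comm_ring_1 \<Rightarrow> 'a::ring_1) \<Rightarrow> ('a \<Rightarrow> 'r) \<Rightarrow> nat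
    \<Rightarrow> (('a, 'r) vec list \<Rightarrow> 'r) set" where
  "cl_ideal emb qA n = fa_ideal (Vset n) (cl_gens emb qA n)"

type_synonym 'a amat = "nat \<Rightarrow> nat \<Rightarrow> 'a"

definition Mset :: "nat \<Rightarrow> 'a::zero amat set" where
  "Mset d = {X. \<forall>i j. (d \<le> i \<or> d \<le> j) \<longrightarrow> X i j = 0}"

definition scal :: "nat \<Rightarrow> 'a::zero \<Rightarrow> 'a amat" where
  "scal d c = (\<lambda>i j. if i < d \<and> j < d \<and> i = j then c else 0)"

definition mneg :: "'a::uminus amat \<Rightarrow> 'a amat" where
  "mneg X = (\<lambda>i j. - X i j)"

definition mmul :: "nat \<Rightarrow> 'a::semiring_1 amat \<Rightarrow> 'a amat \<Rightarrow> 'a amat" where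
  "mmul d X Y = (\<lambda>i j. if i < d \<and> j < d then (\<Sum>k<d. X i k * Y k j) else 0)"

definition blk :: "nat \<Rightarrow> 'a::zero amat \<Rightarrow> 'a amat \<Rightarrow> 'a amat \<Rightarrow> 'a amat \<Rightarrow> 'a amat" where
  "blk d P Q S T = (\<lambda>i j. if i < 2 * d \<and> j < 2 * d then
      (if i < d then (if j < d then P i j else Q i (j - d))
       else (if j < d then S (i - d) j else T (i - d) (j - d))) else 0)"

text \<open>Zpair i x = (Z_i(x), conj(Z_i)(x)) of size 2^i; Z_0 = alpha, conj(Z_0) = conj alpha
  (1 x 1), so that Z_1 = [[a_1, alpha], [-conj alpha, b_1]] as in the paper.\<close>
fun Zpair :: "('r::comm_ring_1 \<Rightarrow> 'a::ring_1) \<Rightarrow> ('a \<Rightarrow> 'r) \<Rightarrow> nat \<Rightarrow> ('a, 'r) vec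
    \<Rightarrow> 'a amat \<times> 'a amat" where
  "Zpair emb qA 0 (\<alpha>, v, w) = (scal 1 \<alpha>, scal 1 (conjA emb qA \<alpha>))"
| "Zpair emb qA (Suc i) (\<alpha>, v, w) =
     (let ZZ = Zpair emb qA i (\<alpha>, v, w); Z = fst ZZ; Zb = snd ZZ; d = 2 ^ i;
          a = emb (v i); b = emb (w i)
      in (blk d (scal d a) Z (mneg Zb) (scal d b),
          blk d (scal d b) (mneg Z) Zb (scal d a)))"

definition Phi :: "('r::comm_ring_1 \<Rightarrow> 'a::ring_1) \<Rightarrow> ('a \<Rightarrow> 'r) \<Rightarrow> nat \<Rightarrow> ('a, 'r) vec \<Rightarrow> 'a amat" where
  "Phi emb qA n x = blk (2 ^ n) (\<lambda>_ _. 0) (fst (Zpair emb qA n x)) (snd (Zpair emb qA n x)) (\<lambda>_ _. 0)"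

definition phi_word :: "('r::comm_ring_1 \<Rightarrow> 'a::ring_1) \<Rightarrow> ('a \<Rightarrow> 'r) \<Rightarrow> nat \<Rightarrow> ('a, 'r) vec list
    \<Rightarrow> 'a amat" where
  "phi_word emb qA n u = foldr (\<lambda>x M. mmul (2 ^ Suc n) (Phi emb qA n x) M) u (scal (2 ^ Suc n) 1)"

text \<open>The induced R-algebra homomorphism from the free algebra on V to M_{2^(n+1)}(A);
  phi on Cl(V) is the map it induces on the quotient by cl_ideal.\<close>
definition phi_ext :: "('r::comm_ring_1 \<Rightarrow> 'a::ring_1) \<Rightarrow> ('a \<Rightarrow> 'r) \<Rightarrow> nat
    \<Rightarrow> (('a, 'r) vec list \<Rightarrow> 'r) \<Rightarrow> 'a amat" where
  "phi_ext emb qA n t = (\<lambda>i j. \<Sum>u\<in>{u. t u \<noteq> 0}. emb (t u) * phi_word emb qA n u i j)"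

end

theory Submission
  imports Defs HOL.Modules "HOL-Library.Function_Algebras" "HOL-Library.Product_Plus"
begin

text \<open>
  The monomials \<open>e\<^sub>S\<close> in a basis \<open>e\<close> of \<open>V\<close> span the Clifford algebra, so it suffices that
  their images under \<open>\<phi>\<close> are linearly independent. Consider the twisted derivations
  \<open>\<partial>\<^sub>v x = v x - x' v\<close>, where \<open>x'\<close> is the grade involution; they satisfy
  \<open>\<partial>\<^sub>v e\<^sub>i = \<langle>v, e\<^sub>i\<rangle>\<close>. On matrices the grade involution is a sign change of the off-diagonal
  blocks, so \<open>\<partial>\<^sub>v\<close> acts on relations between the images and lowers their degree. If
  \<open>\<Sum> c\<^sub>S \<phi>(e\<^sub>S) = 0\<close>, then by induction on the degree the coefficients
  \<open>\<langle>v, \<Sum> \<plusminus> c\<^bsub>T \<union> {i}\<^esub> e\<^sub>i\<rangle>\<close> of the derived relation vanish for all \<open>v\<close>, and non-degeneracy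
  gives \<open>c\<^sub>S = 0\<close> for \<open>S \<noteq> {}\<close>, hence also for \<open>S = {}\<close>. This never divides by the Gram
  determinant, which need not be a unit. Both algebras have rank \<open>2\<^bsup>2n+4\<^esup>\<close>.
\<close>

lemma sum_fun_apply: "(\<Sum>i\<in>A. f i) x = (\<Sum>i\<in>A. f i x)"
  by (induction A rule: infinite_finite_induct) auto

subsection \<open>The free algebra\<close>

lemma fa_add_eq: "fa_add s t = s + t"
  by (simp add: fa_add_def fun_eq_iff)

lemma fa_diff_eq: "fa_diff s t = s - t"
  by (simp add: fa_diff_def fun_eq_iff)

text \<open>The module consists of all functions on words, so that the library notions
  \<open>fa.span\<close> and \<open>fa.subspace\<close> apply. Finite support is not built in; it is
  carried by the submodule of those \<open>t\<close> with \<open>fa_elem X t\<close>.\<close>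

interpretation fa: module "fa_smul :: 'r::comm_ring_1 \<Rightarrow> ('x list \<Rightarrow> 'r) \<Rightarrow> ('x list \<Rightarrow> 'r)"
  by standard (simp_all add: fa_smul_def fun_eq_iff algebra_simps)

lemma fa_mul_add_left: "fa_mul (s + t) u = fa_mul s u + fa_mul t u"
  by (simp add: fa_mul_def fun_eq_iff distrib_right sum.distrib)

lemma fa_mul_add_right: "fa_mul u (s + t) = fa_mul u s + fa_mul u t"
  by (simp add: fa_mul_def fun_eq_iff distrib_left sum.distrib)

lemma fa_mul_diff_left: "fa_mul (s - t) u = fa_mul s u - fa_mul t u"
  by (simp add: fa_mul_def fun_eq_iff left_diff_distrib sum_subtractf)

lemma fa_mul_diff_right: "fa_mul u (s - t) = fa_mul u s - fa_mul u t"
  by (simp add: fa_mul_def fun_eq_iff right_diff_distrib sum_subtractf)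

lemma fa_mul_smul_left: "fa_mul (fa_smul r s) t = fa_smul r (fa_mul s t)"
  by (simp add: fa_mul_def fa_smul_def fun_eq_iff sum_distrib_left mult.assoc)

lemma fa_mul_smul_right: "fa_mul s (fa_smul r t) = fa_smul r (fa_mul s t)"
  by (simp add: fa_mul_def fa_smul_def fun_eq_iff sum_distrib_left mult.left_commute)

lemma fa_mul_zero_left: "fa_mul 0 t = 0"
  by (simp add: fa_mul_def fun_eq_iff)

lemma fa_mul_zero_right: "fa_mul t 0 = 0"
  by (simp add: fa_mul_def fun_eq_iff)

text \<open>Among all ways of cutting a word in two, only the cut after \<open>length p\<close> can
  contribute, and only for the word \<open>p @ q\<close>.\<close>

lemma fa_mul_word: "fa_mul (fa_word p) (fa_word q) = (fa_word (p @ q) :: 'x list \<Rightarrow> 'r::comm_ring_1)"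
proof
  fix u
  have split: "take k u = p \<and> drop k u = q \<longleftrightarrow> k = length p \<and> u = p @ q" if "k \<le> length u" for k
    using that by (auto simp: append_eq_conv_conj)
  have "fa_mul (fa_word p) (fa_word q) u =
      (\<Sum>k\<le>length u. if take k u = p \<and> drop k u = q then 1 else (0::'r))"
    unfolding fa_mul_def fa_word_def by (intro sum.cong) auto
  also have "\<dots> = (\<Sum>k\<le>length u. if k = length p then (if u = p @ q then 1 else 0) else 0)"
    by (intro sum.cong) (use split in auto)
  also have "\<dots> = fa_word (p @ q) u"
    by (simp add: fa_word_def)
  finally show "fa_mul (fa_word p) (fa_word q) u = (fa_word (p @ q) u :: 'r)" .
qed

lemma fa_const_eq: "fa_const (r :: 'r::comm_ring_1) = fa_smul r (fa_word [])"
  by (auto simp: fa_const_def fa_smul_def fa_word_def fun_eq_iff)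

lemma fa_mul_unit_left: "fa_mul (fa_word []) t = t"
proof
  fix u
  have "fa_mul (fa_word []) t u = (\<Sum>k\<le>length u. if k = 0 then t u else 0)"
    unfolding fa_mul_def by (intro sum.cong) (auto simp: fa_word_def)
  then show "fa_mul (fa_word []) t u = t u"
    by simp
qed

section \<open>Finitely supported elements on words over \<open>X\<close>\<close>

lemma fa_elem_zero: "fa_elem X 0"
  by (simp add: fa_elem_def)

lemma fa_elem_word: "set u \<subseteq> X \<Longrightarrow> fa_elem X (fa_word u)"
  by (simp add: fa_elem_def fa_word_def)

lemma fa_elem_add:
  fixes s t :: "'x list \<Rightarrow> 'r::comm_ring_1"
  assumes "fa_elem X s" "fa_elem X t"
  shows "fa_elem X (s + t)"
  unfolding fa_elem_def
proof
  have "finite ({u. s u \<noteq> 0} \<union> {u. t u \<noteq> 0})"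
    using assms by (simp add: fa_elem_def)
  then show "finite {u. (s + t) u \<noteq> 0}"
    by (rule rev_finite_subset) auto
  show "\<forall>u. (s + t) u \<noteq> 0 \<longrightarrow> set u \<subseteq> X"
    using assms unfolding fa_elem_def by (metis add.right_neutral plus_fun_apply)
qed

lemma fa_elem_smul:
  fixes t :: "'x list \<Rightarrow> 'r::comm_ring_1"
  assumes "fa_elem X t"
  shows "fa_elem X (fa_smul r t)"
  unfolding fa_elem_def
proof
  show "finite {u. fa_smul r t u \<noteq> 0}"
    by (rule rev_finite_subset[of "{u. t u \<noteq> 0}"]) (use assms in \<open>auto simp: fa_elem_def fa_smul_def\<close>)
  show "\<forall>u. fa_smul r t u \<noteq> 0 \<longrightarrow> set u \<subseteq> X"
    using assms unfolding fa_elem_def fa_smul_def by (metis mult_zero_right)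
qed

lemma subspace_fa_elem: "fa.subspace {t. fa_elem X t}"
  by (rule fa.subspaceI) (auto simp: fa_elem_zero fa_elem_add fa_elem_smul)

lemma fa_expand:
  fixes t :: "'x list \<Rightarrow> 'r::comm_ring_1"
  assumes "fa_elem X t"
  shows "t = (\<Sum>u | t u \<noteq> 0. fa_smul (t u) (fa_word u))"
proof
  fix v
  have "finite {u. t u \<noteq> 0}"
    using assms by (simp add: fa_elem_def)
  then show "t v = (\<Sum>u | t u \<noteq> 0. fa_smul (t u) (fa_word u)) v"
    by (simp add: sum_fun_apply fa_smul_def fa_word_def if_distrib cong: if_cong)
qed

text \<open>Elements satisfying \<open>fa_elem X\<close> and \<open>P\<close> form a submodule that
  contains all words over \<open>X\<close>, and \<open>t\<close> is a finite combination of such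
  words. Finite support is supplied in the \<open>add\<close> and \<open>smul\<close> cases because
  additivity and homogeneity of \<open>phi_ext\<close> are proved for finite support.\<close>

lemma fa_elem_induct [consumes 1, case_names zero word add smul]:
  fixes t :: "'x list \<Rightarrow> 'r::comm_ring_1"
  assumes "fa_elem X t"
    and zero: "P 0"
    and word: "\<And>u. set u \<subseteq> X \<Longrightarrow> P (fa_word u)"
    and add: "\<And>s t. fa_elem X s \<Longrightarrow> fa_elem X t \<Longrightarrow> P s \<Longrightarrow> P t \<Longrightarrow> P (s + t)"
    and smul: "\<And>r t. fa_elem X t \<Longrightarrow> P t \<Longrightarrow> P (fa_smul r t)"
  shows "P t"
proof -
  have "fa.subspace {t. fa_elem X t \<and> P t}"
    by (rule fa.subspaceI) (auto simp: fa_elem_zero fa_elem_add fa_elem_smul zero add smul)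
  moreover have "fa_word u \<in> {t. fa_elem X t \<and> P t}" if "t u \<noteq> 0" for u
  proof -
    have "set u \<subseteq> X"
      using assms(1) that by (simp add: fa_elem_def)
    then show ?thesis
      by (simp add: fa_elem_word word)
  qed
  ultimately have "(\<Sum>u | t u \<noteq> 0. fa_smul (t u) (fa_word u)) \<in> {t. fa_elem X t \<and> P t}"
    by (intro fa.subspace_sum fa.subspace_scale) auto
  then show ?thesis
    using fa_expand[OF assms(1)] by simp
qed

lemma fa_elem_mul:
  fixes s t :: "'x list \<Rightarrow> 'r::comm_ring_1"
  assumes "fa_elem X s" "fa_elem X t"
  shows "fa_elem X (fa_mul s t)"
  using assms(1)
proof (induction s rule: fa_elem_induct)
  case (word u)
  from assms(2) show ?case
  proof (induction t rule: fa_elem_induct)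
    case (word v)
    with \<open>set u \<subseteq> X\<close> show ?case
      by (simp add: fa_mul_word fa_elem_word)
  qed (simp_all add: fa_mul_zero_right fa_elem_zero fa_mul_add_right fa_elem_add
      fa_mul_smul_right fa_elem_smul del: zero_fun_apply plus_fun_apply)
qed (simp_all add: fa_mul_zero_left fa_elem_zero fa_mul_add_left fa_elem_add
    fa_mul_smul_left fa_elem_smul del: zero_fun_apply plus_fun_apply)

lemma subspace_fa_ideal: "fa.subspace (fa_ideal X G)"
proof (rule fa.subspaceI)
  show "0 \<in> fa_ideal X G"
    using fa_ideal.zero by (simp add: zero_fun_def)
  show "s + t \<in> fa_ideal X G" if "s \<in> fa_ideal X G" "t \<in> fa_ideal X G" for s t
    using fa_ideal.add[OF that] by (simp add: fa_add_eq)
  show "fa_smul r t \<in> fa_ideal X G" if "t \<in> fa_ideal X G" for r t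
    \<comment> \<open>Closure under scalars is not a rule of \<open>fa_ideal\<close>; it is left
      multiplication by a constant.\<close>
    using fa_ideal.lmul[OF that, of "fa_const r"]
    by (simp add: fa_const_eq fa_mul_smul_left fa_mul_unit_left fa_elem_smul fa_elem_word)
qed

lemma fa_ideal_subset_elem:
  assumes "\<And>g. g \<in> G \<Longrightarrow> fa_elem X g" "t \<in> fa_ideal X G"
  shows "fa_elem X t"
  using assms(2)
  by induction (use assms(1) fa_elem_zero[of X] in
      \<open>simp_all add: fa_add_eq fa_elem_add fa_elem_mul flip: zero_fun_def del: zero_fun_apply plus_fun_apply\<close>)

subsection \<open>Matrices\<close>

text \<open>The factor is any element of \<open>A\<close>, acting from the left; only for central
  factors does it pass through the left factor of a product, as in \<open>mmul_msmul_right\<close>.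
  Scalars from \<open>R\<close> enter as \<open>msmul (emb r)\<close>.\<close>

definition msmul :: "'a::ring_1 \<Rightarrow> 'a amat \<Rightarrow> 'a amat" where
  "msmul c X = (\<lambda>i j. c * X i j)"

lemma mmul_add_left: "mmul d (X + Y) Z = mmul d X Z + mmul d Y Z"
  by (simp add: mmul_def fun_eq_iff distrib_right sum.distrib)

lemma mmul_add_right: "mmul d Z (X + Y) = mmul d Z X + mmul d Z Y"
  by (simp add: mmul_def fun_eq_iff distrib_left sum.distrib)

lemma mmul_diff_right: "mmul d Z (X - Y) = mmul d Z X - mmul d (Z :: 'a::ring_1 amat) Y"
  by (simp add: mmul_def fun_eq_iff right_diff_distrib sum_subtractf)

lemma mmul_minus_left: "mmul d (- X) Z = - mmul d X (Z :: 'a::ring_1 amat)"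
  by (simp add: mmul_def fun_eq_iff sum_negf)

lemma mmul_minus_right: "mmul d Z (- X) = - mmul d (Z :: 'a::ring_1 amat) X"
  by (simp add: mmul_def fun_eq_iff sum_negf)

lemma mmul_zero_left: "mmul d 0 X = 0"
  by (simp add: mmul_def fun_eq_iff)

lemma mmul_zero_right: "mmul d X 0 = 0"
  by (simp add: mmul_def fun_eq_iff)

lemma mmul_msmul_left: "mmul d (msmul c X) Y = msmul c (mmul d X Y)"
  by (simp add: mmul_def msmul_def fun_eq_iff sum_distrib_left mult.assoc)

lemma mmul_msmul_right:
  assumes "\<And>x. c * x = x * c"
  shows "mmul d X (msmul c Y) = msmul c (mmul d X Y)"
proof -
  have "X i k * (c * Y k j) = c * (X i k * Y k j)" for i j k
    by (metis assms mult.assoc)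
  then show ?thesis
    by (simp add: mmul_def msmul_def fun_eq_iff sum_distrib_left)
qed

lemma mmul_assoc: "mmul d (mmul d X Y) Z = mmul d X (mmul d Y Z)"
proof (intro ext)
  fix i j
  have "(\<Sum>k<d. (\<Sum>l<d. X i l * Y l k) * Z k j) = (\<Sum>l<d. X i l * (\<Sum>k<d. Y l k * Z k j))"
    by (simp add: sum_distrib_left sum_distrib_right mult.assoc) (rule sum.swap)
  then show "mmul d (mmul d X Y) Z i j = mmul d X (mmul d Y Z) i j"
    by (simp add: mmul_def)
qed

lemma mmul_in_Mset: "mmul d X Y \<in> Mset d"
  by (simp add: mmul_def Mset_def)

lemma scal_in_Mset: "scal d c \<in> Mset d"
  by (simp add: scal_def Mset_def)

lemma blk_in_Mset: "blk d P Q S T \<in> Mset (2 * d)"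
  by (simp add: blk_def Mset_def)

lemma mmul_scal_left:
  assumes "X \<in> Mset d"
  shows "mmul d (scal d c) X = msmul c X"
proof (intro ext)
  fix i j
  have "(\<Sum>k<d. scal d c i k * X k j) = (\<Sum>k<d. if k = i then c * X i j else 0)"
    by (intro sum.cong) (auto simp: scal_def)
  then show "mmul d (scal d c) X i j = msmul c X i j"
    using assms by (auto simp: mmul_def msmul_def Mset_def)
qed

lemma mmul_scal_right:
  assumes "X \<in> Mset d" "\<And>x. c * x = x * c"
  shows "mmul d X (scal d c) = msmul c X"
proof (intro ext)
  fix i j
  have "(\<Sum>k<d. X i k * scal d c k j) = (\<Sum>k<d. if k = j then c * X i j else 0)"
    by (intro sum.cong) (auto simp: scal_def assms(2))
  then show "mmul d X (scal d c) i j = msmul c X i j"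
    using assms(1) by (auto simp: mmul_def msmul_def Mset_def)
qed

lemma msmul_scal: "msmul c (scal d x) = scal d (c * x)"
  by (simp add: msmul_def scal_def fun_eq_iff)

lemma scal_add: "scal d (x + y) = scal d x + scal d (y :: 'a::ring_1)"
  by (simp add: scal_def fun_eq_iff)

lemma mneg_eq: "mneg X = - X"
  by (simp add: mneg_def fun_eq_iff)

lemma blk_add: "blk d (P + P') (Q + Q') (S + S') (T + T') =
    blk d P Q S T + blk d P' Q' S' (T' :: 'a::ring_1 amat)"
  by (simp add: blk_def fun_eq_iff)

lemma msmul_blk: "msmul c (blk d P Q S T) = blk d (msmul c P) (msmul c Q) (msmul c S) (msmul c T)"
  by (simp add: blk_def msmul_def fun_eq_iff)

lemma sum_lessThan_double:
  fixes f :: "nat \<Rightarrow> 'b::comm_monoid_add"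
  shows "(\<Sum>k<2 * d. f k) = (\<Sum>k<d. f k) + (\<Sum>k<d. f (d + k))"
  using sum.nat_group[of f d 2] sum.shift_bounds_nat_ivl[of f 0 d d]
  by (simp add: mult.commute numeral_2_eq_2 lessThan_atLeast0 add.commute)

lemma mmul_blk:
  "mmul (2 * d) (blk d P Q S T) (blk d P' Q' S' T') =
   blk d (mmul d P P' + mmul d Q S') (mmul d P Q' + mmul d Q T')
         (mmul d S P' + mmul d T S') (mmul d S Q' + mmul d T T')"
proof (intro ext)
  fix i j
  have [simp]: "k < d \<Longrightarrow> k < 2 * d" for k
    by simp
  show "mmul (2 * d) (blk d P Q S T) (blk d P' Q' S' T') i j =
   blk d (mmul d P P' + mmul d Q S') (mmul d P Q' + mmul d Q T')
         (mmul d S P' + mmul d T S') (mmul d S Q' + mmul d T T') i j"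
  proof (cases "i < 2 * d \<and> j < 2 * d")
    case True
    then have "i - d < d" "j - d < d"
      by auto
    with True show ?thesis
      by (cases "i < d"; cases "j < d") (simp_all add: mmul_def blk_def sum_lessThan_double)
  qed (auto simp: mmul_def blk_def)
qed

lemma blk_scal: "blk d (scal d c) 0 0 (scal d c) = scal (2 * d) c"
  by (auto simp: blk_def scal_def fun_eq_iff)

lemma msmul_add_left: "msmul (a + b) X = msmul a X + msmul b X"
  by (simp add: msmul_def fun_eq_iff distrib_right)

lemma msmul_diff_right: "msmul c (X - Y) = msmul c X - msmul c Y"
  by (simp add: msmul_def fun_eq_iff right_diff_distrib)

lemma msmul_minus_right: "msmul c (- X) = - msmul c X"
  by (simp add: msmul_def fun_eq_iff)

lemma msmul_minus_left: "msmul (- c) X = - msmul c X"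
  by (simp add: msmul_def fun_eq_iff)

lemma msmul_msmul: "msmul a (msmul b X) = msmul (a * b) X"
  by (simp add: msmul_def fun_eq_iff mult.assoc)

lemma msmul_zero_left: "msmul 0 X = 0"
  by (simp add: msmul_def fun_eq_iff)

lemma msmul_zero_right: "msmul c 0 = 0"
  by (simp add: msmul_def fun_eq_iff)

lemma msmul_one: "msmul 1 X = X"
  by (simp add: msmul_def fun_eq_iff)

lemma msmul_sum_right: "msmul c (\<Sum>i\<in>A. f i) = (\<Sum>i\<in>A. msmul c (f i))"
  by (simp add: msmul_def fun_eq_iff sum_fun_apply sum_distrib_left)

lemma mmul_sum_right: "mmul d X (\<Sum>i\<in>A. f i) = (\<Sum>i\<in>A. mmul d X (f i))"
  by (induction A rule: infinite_finite_induct)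
    (simp_all add: mmul_zero_right mmul_add_right del: zero_fun_apply plus_fun_apply)

text \<open>Conjugation by the block matrix \<open>diag(1, -1)\<close>.\<close>

definition grade :: "nat \<Rightarrow> 'a::ring_1 amat \<Rightarrow> 'a amat" where
  "grade d X = (\<lambda>i j. if i < d \<longleftrightarrow> j < d then X i j else - X i j)"

lemma grade_add: "grade d (X + Y) = grade d X + grade d Y"
  by (simp add: grade_def fun_eq_iff)

lemma grade_msmul: "grade d (msmul c X) = msmul c (grade d X)"
  by (simp add: grade_def msmul_def fun_eq_iff)

lemma grade_zero: "grade d 0 = 0"
  by (simp add: grade_def fun_eq_iff)

lemma grade_scal: "grade d (scal d' c) = scal d' c"
  by (auto simp: grade_def scal_def fun_eq_iff)

text \<open>The sign at position (i, j) is a product of a sign depending on i and one depending on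
  j. In each summand of the matrix product the two signs of the inner index k cancel.\<close>

lemma grade_mmul: "grade d (mmul d' X Y) = mmul d' (grade d X) (grade d Y)"
proof (intro ext)
  fix i j
  have "(\<Sum>k<d'. grade d X i k * grade d Y k j) =
      (\<Sum>k<d'. if i < d \<longleftrightarrow> j < d then X i k * Y k j else - (X i k * Y k j))"
    by (intro sum.cong refl) (simp add: grade_def)
  then show "grade d (mmul d' X Y) i j = mmul d' (grade d X) (grade d Y) i j"
    by (auto simp: mmul_def grade_def sum_negf)
qed

lemma grade_blk_odd: "grade d (blk d 0 Q S 0) = - blk d 0 Q S 0"
  by (auto simp: grade_def blk_def fun_eq_iff)

subsection \<open>Composition algebras\<close>

lemma polarA_commute: "polarA qA x y = polarA qA y x"
  by (simp add: polarA_def add.commute)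

locale composition =
  fixes emb :: "'r::comm_ring_1 \<Rightarrow> 'a::ring_1" and qA :: "'a \<Rightarrow> 'r" and m :: nat
  assumes composition: "composition_algebra emb qA m"
begin

abbreviation "polar \<equiv> polarA qA"

abbreviation "cnj \<equiv> conjA emb qA"

lemma emb_one [simp]: "emb 1 = 1"
  and emb_add: "emb (r + s) = emb r + emb s"
  and emb_mult: "emb (r * s) = emb r * emb s"
  and inj_emb: "inj emb"
  and emb_central: "emb r * x = x * emb r"
  and polar_add_left: "polar (x + y) z = polar x z + polar y z"
  and polar_smul_left: "polar (emb r * x) z = r * polar x z"
  and polar_nondeg: "(\<And>y. polar x y = 0) \<Longrightarrow> x = 0"
  and qA_mult: "qA (x * y) = qA x * qA y"
  using composition unfolding composition_algebra_def by (elim conjE; iprover)+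

lemma basis_ex:
  obtains b :: "nat \<Rightarrow> 'a" where "\<And>x. \<exists>c. x = (\<Sum>i<m. emb (c i) * b i)"
    and "\<And>c i. (\<Sum>i<m. emb (c i) * b i) = 0 \<Longrightarrow> i < m \<Longrightarrow> c i = 0"
proof -
  from composition obtain b :: "nat \<Rightarrow> 'a" where
    "\<forall>x. \<exists>c. x = (\<Sum>i<m. emb (c i) * b i)"
    "\<forall>c. (\<Sum>i<m. emb (c i) * b i) = 0 \<longrightarrow> (\<forall>i<m. c i = 0)"
    unfolding composition_algebra_def by (elim conjE exE)
  then show ?thesis
    by (intro that[of b]; iprover)
qed

lemma emb_zero [simp]: "emb 0 = 0"
  using emb_add[of 0 0] by simp

lemma emb_minus: "emb (- r) = - emb r"
  using emb_add[of r "- r"] by (simp add: eq_neg_iff_add_eq_0 add.commute)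

lemma emb_sum: "emb (\<Sum>i\<in>A. f i) = (\<Sum>i\<in>A. emb (f i))"
  by (induction A rule: infinite_finite_induct) (simp_all add: emb_add)

lemma emb_eq_zero_iff: "emb r = 0 \<longleftrightarrow> r = 0"
  using inj_emb by (metis emb_zero injD)

lemma polar_add_right: "polar z (x + y) = polar z x + polar z y"
  using polar_add_left[of x y z] by (simp add: polarA_commute)

lemma polar_smul_right: "polar z (emb r * x) = r * polar z x"
  using polar_smul_left[of r x z] by (simp add: polarA_commute)

lemma polar_zero_left [simp]: "polar 0 z = 0"
  using polar_add_left[of 0 0 z] by simp

lemma polar_zero_right [simp]: "polar z 0 = 0"
  using polar_add_right[of z 0 0] by simp

lemma polar_minus_left: "polar (- x) z = - polar x z"
  using polar_smul_left[of "- 1" x z] by (simp add: emb_minus)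

lemma polar_sum_right: "polar z (\<Sum>i\<in>A. f i) = (\<Sum>i\<in>A. polar z (f i))"
  by (induction A rule: infinite_finite_induct) (simp_all add: polar_add_right)

text \<open>Polarization of the multiplicativity of \<open>qA\<close> in the second factor;
  \<open>polar_exchange\<close> below then polarizes in the first factor as well.\<close>

lemma polar_mult_left: "polar (x * y) (x * z) = qA x * polar y z"
  by (simp add: polarA_def qA_mult algebra_simps flip: distrib_left)

lemma polar_exchange: "polar (x * y) (x' * z) + polar (x' * y) (x * z) = polar x x' * polar y z"
proof -
  have "polar ((x + x') * y) ((x + x') * z) = qA (x + x') * polar y z"
    by (rule polar_mult_left)
  moreover have "qA (x + x') = qA x + qA x' + polar x x'"
    by (simp add: polarA_def)
  ultimately show ?thesis
    by (simp add: distrib_right polar_add_left polar_add_right polar_mult_left algebra_simps)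
qed

text \<open>The difference of the two sides is orthogonal to every element, so it vanishes by
  non-degeneracy. Neither division by 2 nor a basis is involved.\<close>

lemma quadratic_relation: "x * x = emb (polar x 1) * x - emb (qA x)"
proof -
  \<comment> \<open>The terms are written with unary minus and a factor 1 so that additivity and
    homogeneity of \<open>polar\<close> apply to each of them.\<close>
  have "polar (x * x + - (emb (polar x 1) * x) + emb (qA x) * 1) y = 0" for y
  proof -
    have "polar (x * x) y = polar x 1 * polar x y - qA x * polar 1 y"
      \<comment> \<open>The exchange identity for the left factors x, 1 and the right factors x, y;
        its second term is \<open>polar x (x * y)\<close>, which is
        \<open>qA x * polar 1 y\<close>.\<close>
      using polar_exchange[of x x 1 y] polar_mult_left[of x 1 y] by (simp add: eq_diff_eq)
    then show ?thesis
      by (simp only: polar_add_left polar_minus_left polar_smul_left) simp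
  qed
  then have "x * x + - (emb (polar x 1) * x) + emb (qA x) * 1 = 0"
    by (rule polar_nondeg)
  then show ?thesis
    by (simp add: algebra_simps eq_neg_iff_add_eq_0)
qed

lemma mult_conj: "x * cnj x = emb (qA x)"
  by (simp add: conjA_def right_diff_distrib quadratic_relation flip: emb_central)

lemma conj_mult: "cnj x * x = emb (qA x)"
  by (simp add: conjA_def left_diff_distrib quadratic_relation)

lemma conj_add: "cnj (x + y) = cnj x + cnj y"
  by (simp add: conjA_def polar_add_left emb_add)

lemma conj_smul: "cnj (emb r * x) = emb r * cnj x"
  by (simp add: conjA_def polar_smul_left emb_mult right_diff_distrib)

subsection \<open>The representation of the quadratic module\<close>

abbreviation "Z i x \<equiv> fst (Zpair emb qA i x)"
abbreviation "Zb i x \<equiv> snd (Zpair emb qA i x)"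

lemma Z_0: "Z 0 x = scal 1 (fst x)" "Zb 0 x = scal 1 (cnj (fst x))"
  by (cases x; simp)+

lemma Z_Suc:
  "Z (Suc i) x = blk (2 ^ i) (scal (2 ^ i) (emb (fst (snd x) i))) (Z i x)
     (- Zb i x) (scal (2 ^ i) (emb (snd (snd x) i)))"
  "Zb (Suc i) x = blk (2 ^ i) (scal (2 ^ i) (emb (snd (snd x) i))) (- Z i x)
     (Zb i x) (scal (2 ^ i) (emb (fst (snd x) i)))"
  by (cases x; simp add: Let_def mneg_eq)+

lemma Z_in_Mset: "Z i x \<in> Mset (2 ^ i)" "Zb i x \<in> Mset (2 ^ i)"
  by (cases i; simp only: Z_0 Z_Suc scal_in_Mset blk_in_Mset power_0 power_Suc)+

lemma vadd_eq: "vadd x y = x + (y :: ('a, 'r) vec)"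
  by (cases x; cases y) (simp add: vadd_def plus_fun_def)

lemma Z_add: "Z i (x + y) = Z i x + Z i y \<and> Zb i (x + y) = Zb i x + Zb i y"
proof (induction i)
  case (Suc i)
  have "fst (snd (x + y)) i = fst (snd x) i + fst (snd y) i"
    "snd (snd (x + y)) i = snd (snd x) i + snd (snd y) i"
    by simp_all
  with Suc show ?case
    by (simp only: Z_Suc emb_add scal_add minus_add_distrib blk_add)
qed (simp add: Z_0 conj_add scal_add del: plus_fun_apply)

lemma Z_smul:
  "Z i (vsmul emb r x) = msmul (emb r) (Z i x) \<and> Zb i (vsmul emb r x) = msmul (emb r) (Zb i x)"
proof (induction i)
  case 0
  show ?case
    by (cases x) (simp add: msmul_scal conj_smul vsmul_def)
next
  case (Suc i)
  have "fst (snd (vsmul emb r x)) i = r * fst (snd x) i"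
    "snd (snd (vsmul emb r x)) i = r * snd (snd x) i"
    by (cases x; simp add: vsmul_def)+
  with Suc show ?case
    by (simp add: Z_Suc emb_mult msmul_blk msmul_scal msmul_minus_right)
qed

text \<open>The off-diagonal blocks of the product cancel because scalars are central. The diagonal
  blocks contain \<open>Z i x\<close> and \<open>Zb i x\<close> multiplied in both orders, which is
  why the two identities are proved together.\<close>

lemma Z_mult_Zb:
  "mmul (2 ^ i) (Z i x) (Zb i x) = scal (2 ^ i) (emb (qV qA i x)) \<and>
   mmul (2 ^ i) (Zb i x) (Z i x) = scal (2 ^ i) (emb (qV qA i x))"
proof (induction i)
  case 0
  show ?case
    by (cases x) (simp add: mmul_scal_left scal_in_Mset msmul_scal mult_conj conj_mult qV_def)
next
  case (Suc i)
  have q: "emb (qV qA (Suc i) x) = emb (qV qA i x) + emb (fst (snd x) i) * emb (snd (snd x) i)"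
    by (cases x) (simp add: qV_def emb_add emb_mult algebra_simps)
  have comm: "emb (snd (snd x) i) * emb (fst (snd x) i) = emb (fst (snd x) i) * emb (snd (snd x) i)"
    by (rule emb_central)
  have sum: "scal d c + scal d c' = scal d (c' + c)" for d and c c' :: 'a
    by (simp add: scal_add)
  have "mmul (2 ^ i) X (scal (2 ^ i) (emb r)) = msmul (emb r) X" if "X \<in> Mset (2 ^ i)" for X r
    using that emb_central by (rule mmul_scal_right)
  then show ?case
    by (simp add: Z_Suc mmul_blk mmul_minus_left mmul_minus_right mmul_scal_left
        Z_in_Mset scal_in_Mset Suc msmul_scal q sum comm add.commute
        del: zero_fun_apply plus_fun_apply flip: blk_scal)
qed

lemma Phi_eq: "Phi emb qA n x = blk (2 ^ n) 0 (Z n x) (Zb n x) 0"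
  by (simp add: Phi_def zero_fun_def)

lemma Phi_in_Mset: "Phi emb qA n x \<in> Mset (2 ^ Suc n)"
  unfolding Phi_eq power_Suc by (rule blk_in_Mset)

lemma Phi_add: "Phi emb qA n (x + y) = Phi emb qA n x + Phi emb qA n y"
  by (simp add: Phi_eq Z_add flip: blk_add del: plus_fun_apply)

lemma Phi_smul: "Phi emb qA n (vsmul emb r x) = msmul (emb r) (Phi emb qA n x)"
  by (simp add: Phi_eq Z_smul msmul_blk msmul_zero_right del: zero_fun_apply)

lemma Phi_square:
  "mmul (2 ^ Suc n) (Phi emb qA n x) (Phi emb qA n x) = scal (2 ^ Suc n) (emb (qV qA n x))"
  by (simp add: Phi_eq mmul_blk Z_mult_Zb mmul_zero_left mmul_zero_right flip: blk_scal
      del: zero_fun_apply plus_fun_apply)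

text \<open>The polar form of \<open>qV qA n\<close>, in coordinates: the polar form of
  \<open>qA\<close> plus the hyperbolic pairing of the two halves of H(R^n).\<close>

definition bV :: "nat \<Rightarrow> ('a, 'r) vec \<Rightarrow> ('a, 'r) vec \<Rightarrow> 'r" where
  "bV n x y = polar (fst x) (fst y) +
     (\<Sum>k<n. fst (snd x) k * snd (snd y) k + snd (snd x) k * fst (snd y) k)"

lemma qV_add: "qV qA n (x + y) = qV qA n x + qV qA n y + bV n x y"
  by (cases x; cases y) (simp add: qV_def bV_def polarA_def algebra_simps sum.distrib)

text \<open>Polarization of \<open>Phi_square\<close>: the square of the sum of x and y is expanded
  and both squares are cancelled.\<close>

lemma Phi_anticommute:
  "mmul (2 ^ Suc n) (Phi emb qA n x) (Phi emb qA n y) + mmul (2 ^ Suc n) (Phi emb qA n y) (Phi emb qA n x)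
   = scal (2 ^ Suc n) (emb (bV n x y))"
  using Phi_square[of n "x + y"]
  by (simp add: Phi_add mmul_add_left mmul_add_right Phi_square qV_add emb_add scal_add
      algebra_simps del: plus_fun_apply power_Suc)

lemma grade_Phi: "grade (2 ^ n) (Phi emb qA n x) = - Phi emb qA n x"
  by (simp only: Phi_eq grade_blk_odd)

subsection \<open>Twisted derivations\<close>

definition der :: "nat \<Rightarrow> ('a, 'r) vec \<Rightarrow> 'a amat \<Rightarrow> 'a amat" where
  "der n v M = mmul (2 ^ Suc n) (Phi emb qA n v) M
     - mmul (2 ^ Suc n) (grade (2 ^ n) M) (Phi emb qA n v)"

lemma der_add: "der n v (X + Y) = der n v X + der n v Y"
  by (simp add: der_def grade_add mmul_add_left mmul_add_right
      del: plus_fun_apply power_Suc)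

lemma der_zero: "der n v 0 = 0"
  by (simp add: der_def grade_zero mmul_zero_left mmul_zero_right
      del: zero_fun_apply power_Suc)

lemma der_msmul: "der n v (msmul (emb r) X) = msmul (emb r) (der n v X)"
  by (simp add: der_def grade_msmul mmul_msmul_left mmul_msmul_right[OF emb_central]
      msmul_diff_right del: power_Suc)

lemma der_sum: "der n v (\<Sum>i\<in>A. f i) = (\<Sum>i\<in>A. der n v (f i))"
  by (induction A rule: infinite_finite_induct)
    (simp_all add: der_zero der_add del: zero_fun_apply plus_fun_apply)

lemma der_one: "der n v (scal (2 ^ Suc n) 1) = 0"
  by (simp add: der_def grade_scal mmul_scal_left mmul_scal_right Phi_in_Mset del: power_Suc)

text \<open>The twisted Leibniz rule. Since \<open>Phi\<close> is odd under \<open>grade\<close>,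
  applying the derivation to the factor x yields the anticommutator of v and x, a scalar; moving
  past x costs a sign.\<close>

lemma der_Phi_mult:
  assumes "M \<in> Mset (2 ^ Suc n)"
  shows "der n v (mmul (2 ^ Suc n) (Phi emb qA n x) M) =
    msmul (emb (bV n v x)) M - mmul (2 ^ Suc n) (Phi emb qA n x) (der n v M)"
proof -
  let ?m = "mmul (2 ^ Suc n)" and ?P = "Phi emb qA n"
  have "msmul (emb (bV n v x)) M = ?m (?m (?P v) (?P x) + ?m (?P x) (?P v)) M"
    unfolding Phi_anticommute by (rule mmul_scal_left[OF assms, symmetric])
  then show ?thesis
    by (simp add: der_def grade_mmul grade_Phi mmul_minus_left mmul_add_left mmul_diff_right mmul_assoc
        del: power_Suc plus_fun_apply)
qed

lemma phi_word_in_Mset: "phi_word emb qA n u \<in> Mset (2 ^ Suc n)"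
  by (cases u) (simp_all add: phi_word_def scal_in_Mset mmul_in_Mset del: power_Suc)

lemma phi_word_Nil: "phi_word emb qA n [] = scal (2 ^ Suc n) 1"
  by (simp add: phi_word_def)

lemma phi_word_Cons:
  "phi_word emb qA n (x # u) = mmul (2 ^ Suc n) (Phi emb qA n x) (phi_word emb qA n u)"
  by (simp add: phi_word_def)

lemma phi_word_append:
  "phi_word emb qA n (u @ v) = mmul (2 ^ Suc n) (phi_word emb qA n u) (phi_word emb qA n v)"
proof (induction u)
  case Nil
  show ?case
    unfolding phi_word_Nil append_Nil
    by (simp add: mmul_scal_left phi_word_in_Mset msmul_one del: power_Suc)
qed (simp add: phi_word_Cons mmul_assoc del: power_Suc)

subsection \<open>The induced homomorphism\<close>

abbreviation "\<phi> \<equiv> phi_ext emb qA"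

text \<open>Allows elements with different supports to be summed over one common finite index
  set.\<close>

lemma phi_ext_superset:
  assumes "finite W" "{u. t u \<noteq> 0} \<subseteq> W"
  shows "\<phi> n t = (\<Sum>u\<in>W. msmul (emb (t u)) (phi_word emb qA n u))"
proof (intro ext)
  fix i j
  show "\<phi> n t i j = (\<Sum>u\<in>W. msmul (emb (t u)) (phi_word emb qA n u)) i j"
    unfolding phi_ext_def sum_fun_apply msmul_def
    by (rule sum.mono_neutral_left) (use assms in auto)
qed

lemma phi_ext_word: "\<phi> n (fa_word u) = phi_word emb qA n u"
  by (subst phi_ext_superset[of "{u}"]) (auto simp: fa_word_def msmul_one)

lemma phi_ext_zero: "\<phi> n 0 = 0"
  by (subst phi_ext_superset[of "{}"]) auto

lemma phi_ext_add:
  assumes "fa_elem X s" "fa_elem Y t"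
  shows "\<phi> n (s + t) = \<phi> n s + \<phi> n t"
proof -
  let ?W = "{u. s u \<noteq> 0} \<union> {u. t u \<noteq> 0}"
  have "finite ?W"
    using assms by (simp add: fa_elem_def)
  then show ?thesis
    by (subst (1 2 3) phi_ext_superset[of ?W])
      (auto simp: emb_add msmul_add_left sum.distrib simp del: plus_fun_apply simp: plus_fun_apply[of s t])
qed

lemma phi_ext_smul:
  assumes "fa_elem X t"
  shows "\<phi> n (fa_smul r t) = msmul (emb r) (\<phi> n t)"
proof -
  have "finite {u. t u \<noteq> 0}"
    using assms by (simp add: fa_elem_def)
  then show ?thesis
    by (subst (1 2) phi_ext_superset[of "{u. t u \<noteq> 0}"])
      (auto simp: fa_smul_def emb_mult msmul_sum_right msmul_msmul)
qed

lemma phi_ext_diff: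
  assumes "fa_elem X s" "fa_elem Y t"
  shows "\<phi> n (s - t) = \<phi> n s - \<phi> n t"
proof -
  have t: "fa_smul (- 1) t = - t"
    by (simp add: fa_smul_def fun_eq_iff)
  show ?thesis
    using phi_ext_add[OF assms(1) fa_elem_smul[OF assms(2), of "- 1"], of n]
      phi_ext_smul[OF assms(2), of n "- 1"]
    by (simp add: t emb_minus msmul_minus_left msmul_one)
qed

lemma phi_ext_sum:
  assumes "\<And>i. i \<in> A \<Longrightarrow> fa_elem X (f i)"
  shows "\<phi> n (\<Sum>i\<in>A. fa_smul (c i) (f i)) = (\<Sum>i\<in>A. msmul (emb (c i)) (\<phi> n (f i)))"
proof -
  \<comment> \<open>Finite support of the partial sums is carried through the induction, since
    \<open>phi_ext_add\<close> asks for it.\<close>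
  have "fa_elem X (\<Sum>i\<in>A. fa_smul (c i) (f i)) \<and> ?thesis"
    using assms
  proof (induction A rule: infinite_finite_induct)
    case (insert i A)
    then show ?case
      by (simp add: fa_elem_add fa_elem_smul phi_ext_smul[of X] phi_ext_add[of X _ X]
          del: plus_fun_apply)
  qed (simp_all add: fa_elem_zero phi_ext_zero del: zero_fun_apply)
  then show ?thesis ..
qed

text \<open>Both sides are bilinear, so the claim reduces to two words, where it is compatibility
  with concatenation. Pulling scalars out of the right factor uses centrality of
  \<open>emb\<close>.\<close>

lemma phi_ext_mult:
  assumes "fa_elem X s" "fa_elem X t"
  shows "\<phi> n (fa_mul s t) = mmul (2 ^ Suc n) (\<phi> n s) (\<phi> n t)"
  using assms(1)
proof (induction s rule: fa_elem_induct)
  case (word u)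
  note u = fa_elem_word[OF word]
  from assms(2) show ?case
  proof (induction t rule: fa_elem_induct)
    case (word v)
    show ?case
      by (simp add: fa_mul_word phi_ext_word phi_word_append)
  next
    case (add s t)
    then show ?case
      using fa_elem_mul[OF u add(1)] fa_elem_mul[OF u add(2)]
      by (simp add: fa_mul_add_right phi_ext_add[of X _ X] mmul_add_right
          del: plus_fun_apply)
  next
    case (smul r t)
    then show ?case
      using fa_elem_mul[OF u smul(1)]
      by (simp add: fa_mul_smul_right phi_ext_smul[of X] mmul_msmul_right[OF emb_central])
  qed (simp add: fa_mul_zero_right phi_ext_zero mmul_zero_right del: zero_fun_apply)
next
  case (add s s')
  then show ?case
    using fa_elem_mul[OF add(1) assms(2)] fa_elem_mul[OF add(2) assms(2)]
    by (simp add: fa_mul_add_left phi_ext_add[of X _ X] mmul_add_left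
        del: plus_fun_apply)
next
  case (smul r s)
  then show ?case
    using fa_elem_mul[OF smul(1) assms(2)]
    by (simp add: fa_mul_smul_left phi_ext_smul[of X] mmul_msmul_left)
qed (simp add: fa_mul_zero_left phi_ext_zero mmul_zero_left del: zero_fun_apply)

end

subsection \<open>The Clifford ideal\<close>

lemma zero_in_Vset: "0 \<in> Vset n"
  by (simp add: Vset_def zero_prod_def)

lemma add_in_Vset: "x \<in> Vset n \<Longrightarrow> y \<in> Vset n \<Longrightarrow> x + y \<in> Vset n"
  for x y :: "('a::ring_1, 'r::comm_ring_1) vec"
  by (cases x; cases y) (simp add: Vset_def)

lemma vsmul_in_Vset: "x \<in> Vset n \<Longrightarrow> vsmul emb r x \<in> Vset n"
  for x :: "('a::ring_1, 'r::comm_ring_1) vec"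
  by (cases x) (simp add: Vset_def vsmul_def)

text \<open>Monomials are built by adding the least index, so that the new basis vector becomes the
  first letter.\<close>

lemma sorted_list_of_set_insert_less:
  fixes A :: "'b::linorder set"
  assumes "finite A" "\<And>a. a \<in> A \<Longrightarrow> j < a"
  shows "sorted_list_of_set (insert j A) = j # sorted_list_of_set A"
proof -
  have "j \<notin> A"
    using assms(2) by blast
  with assms show ?thesis
    by (simp add: insort_is_Cons less_imp_le)
qed

context composition
begin

lemma cl_gens_eq:
  "cl_gens emb qA n =
     {fa_word [x + y] - (fa_word [x] + fa_word [y]) | x y. x \<in> Vset n \<and> y \<in> Vset n}
   \<union> {fa_word [vsmul emb r x] - fa_smul r (fa_word [x]) | r x. x \<in> Vset n}
   \<union> {fa_word [x, x] - fa_smul (qV qA n x) (fa_word []) | x. x \<in> Vset n}"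
  by (simp only: cl_gens_def fa_diff_eq fa_add_eq fa_const_eq vadd_eq)

lemma fa_elem_cl_gens:
  assumes "g \<in> cl_gens emb qA n"
  shows "fa_elem (Vset n) g"
proof -
  have diff: "fa_elem (Vset n) (s - t)" if "fa_elem (Vset n) s" "fa_elem (Vset n) t"
    for s t :: "('a, 'r) vec list \<Rightarrow> 'r"
    using fa.subspace_diff[OF subspace_fa_elem] that by simp
  show ?thesis
    using assms unfolding cl_gens_eq
    by (auto simp: add_in_Vset vsmul_in_Vset intro!: diff fa_elem_add fa_elem_smul fa_elem_word
        simp del: plus_fun_apply split_paired_Ex add_Pair)
qed

lemma phi_word_single: "phi_word emb qA n [x] = Phi emb qA n x"
  by (simp add: phi_word_Cons phi_word_Nil mmul_scal_right Phi_in_Mset msmul_one del: power_Suc)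

lemma phi_ext_cl_gens:
  assumes "g \<in> cl_gens emb qA n"
  shows "\<phi> n g = 0"
proof -
  have W: "fa_elem (Vset n) (fa_word u :: ('a, 'r) vec list \<Rightarrow> 'r)" if "set u \<subseteq> Vset n" for u
    using that by (rule fa_elem_word)
  consider (add) x y where "x \<in> Vset n" "y \<in> Vset n"
      "g = fa_word [x + y] - (fa_word [x] + fa_word [y])"
    | (smul) r x where "x \<in> Vset n" "g = fa_word [vsmul emb r x] - fa_smul r (fa_word [x])"
    | (square) x where "x \<in> Vset n" "g = fa_word [x, x] - fa_smul (qV qA n x) (fa_word [])"
    using assms unfolding cl_gens_eq by blast
  then show ?thesis
  proof cases
    case add
    have "\<phi> n g = \<phi> n (fa_word [x + y]) - \<phi> n (fa_word [x] + fa_word [y])"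
      unfolding add(3)
      by (rule phi_ext_diff[of "Vset n" _ "Vset n"]) (simp_all add: W add(1,2) add_in_Vset fa_elem_add del: plus_fun_apply)
    also have "\<phi> n (fa_word [x] + fa_word [y]) = \<phi> n (fa_word [x]) + \<phi> n (fa_word [y])"
      by (rule phi_ext_add[of "Vset n" _ "Vset n"]) (simp_all add: W add(1,2))
    finally show ?thesis
      by (simp add: phi_ext_word phi_word_single Phi_add del: plus_fun_apply zero_fun_apply)
  next
    case smul
    have "\<phi> n g = \<phi> n (fa_word [vsmul emb r x]) - \<phi> n (fa_smul r (fa_word [x]))"
      unfolding smul(2)
      by (rule phi_ext_diff[of "Vset n" _ "Vset n"]) (simp_all add: W smul(1) vsmul_in_Vset fa_elem_smul)
    also have "\<phi> n (fa_smul r (fa_word [x])) = msmul (emb r) (\<phi> n (fa_word [x]))"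
      by (rule phi_ext_smul[of "Vset n"]) (simp add: W smul(1))
    finally show ?thesis
      by (simp add: phi_ext_word phi_word_single Phi_smul del: zero_fun_apply)
  next
    case square
    have "\<phi> n g = \<phi> n (fa_word [x, x]) - \<phi> n (fa_smul (qV qA n x) (fa_word []))"
      unfolding square(2)
      by (rule phi_ext_diff[of "Vset n" _ "Vset n"]) (simp_all add: W square(1) fa_elem_smul)
    also have "\<phi> n (fa_smul (qV qA n x) (fa_word [])) = msmul (emb (qV qA n x)) (\<phi> n (fa_word []))"
      by (rule phi_ext_smul[of "Vset n"]) (simp add: W)
    finally show ?thesis
      by (simp add: phi_ext_word phi_word_single phi_word_Cons[of n x "[x]"] phi_word_Nil Phi_square
          msmul_scal del: power_Suc zero_fun_apply)
  qed
qed

text \<open>This makes the map on the quotient Cl(V) well defined.\<close>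

lemma phi_ext_cl_ideal:
  assumes "t \<in> cl_ideal emb qA n"
  shows "\<phi> n t = 0"
proof -
  \<comment> \<open>The induction over the ideal also has to provide finite support, a hypothesis of
    additivity and multiplicativity of \<open>phi_ext\<close>.\<close>
  have "fa_elem (Vset n) t \<and> \<phi> n t = 0"
    using assms unfolding cl_ideal_def
  proof induction
    case zero
    show ?case
      by (simp add: fa_elem_zero phi_ext_zero flip: zero_fun_def)
  next
    case (gen g)
    then show ?case
      by (simp add: fa_elem_cl_gens phi_ext_cl_gens)
  next
    case (add a b)
    then show ?case
      by (simp add: fa_add_eq fa_elem_add phi_ext_add[of "Vset n" _ "Vset n"] del: zero_fun_apply plus_fun_apply)
  next
    case (lmul a c)
    then show ?case
      by (simp add: fa_elem_mul phi_ext_mult[of "Vset n"] mmul_zero_right del: zero_fun_apply)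
  next
    case (rmul a c)
    then show ?case
      by (simp add: fa_elem_mul phi_ext_mult[of "Vset n"] mmul_zero_left del: zero_fun_apply)
  qed
  then show ?thesis ..
qed

lemma subspace_cl_ideal: "fa.subspace (cl_ideal emb qA n)"
  unfolding cl_ideal_def by (rule subspace_fa_ideal)

lemma cl_ideal_lmul: "a \<in> cl_ideal emb qA n \<Longrightarrow> fa_elem (Vset n) c \<Longrightarrow> fa_mul c a \<in> cl_ideal emb qA n"
  unfolding cl_ideal_def by (rule fa_ideal.lmul)

lemma cl_ideal_rmul: "a \<in> cl_ideal emb qA n \<Longrightarrow> fa_elem (Vset n) c \<Longrightarrow> fa_mul a c \<in> cl_ideal emb qA n"
  unfolding cl_ideal_def by (rule fa_ideal.rmul)

lemma cl_ideal_add: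
  "x \<in> Vset n \<Longrightarrow> y \<in> Vset n \<Longrightarrow>
    fa_word [x + y] - (fa_word [x] + fa_word [y]) \<in> cl_ideal emb qA n"
  unfolding cl_ideal_def cl_gens_eq by (rule fa_ideal.gen) blast

lemma cl_ideal_smul:
  "x \<in> Vset n \<Longrightarrow> fa_word [vsmul emb r x] - fa_smul r (fa_word [x]) \<in> cl_ideal emb qA n"
  unfolding cl_ideal_def cl_gens_eq by (rule fa_ideal.gen) blast

lemma cl_ideal_square:
  "x \<in> Vset n \<Longrightarrow> fa_word [x, x] - fa_smul (qV qA n x) (fa_word []) \<in> cl_ideal emb qA n"
  unfolding cl_ideal_def cl_gens_eq by (rule fa_ideal.gen) blast

text \<open>Modulo the ideal, the square of the letter \<open>x + y\<close> equals the square of the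
  sum of the letters x and y; comparison with the three relations for squares leaves the polar
  form.\<close>

lemma cl_ideal_anticommute:
  assumes x: "x \<in> Vset n" and y: "y \<in> Vset n"
  shows "fa_word [x, y] + fa_word [y, x] - fa_smul (bV n x y) (fa_word []) \<in> cl_ideal emb qA n"
proof -
  let ?I = "cl_ideal emb qA n"
  let ?W = "fa_word :: ('a, 'r) vec list \<Rightarrow> ('a, 'r) vec list \<Rightarrow> 'r"
  note sub = subspace_cl_ideal[of n]
  let ?g = "?W [x + y] - (?W [x] + ?W [y])"
  have g: "?g \<in> ?I"
    using x y by (rule cl_ideal_add)
  \<comment> \<open>With P the letter \<open>x + y\<close> and Q the sum of the letters, (P - Q) P +
    Q (P - Q) = P P - Q Q.\<close>
  have "fa_mul ?g (?W [x + y]) + fa_mul (?W [x] + ?W [y]) ?g \<in> ?I"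
    using x y g by (intro fa.subspace_add[OF sub] cl_ideal_lmul cl_ideal_rmul fa_elem_add fa_elem_word)
      (simp_all add: add_in_Vset)
  also have "fa_mul ?g (?W [x + y]) + fa_mul (?W [x] + ?W [y]) ?g =
      ?W [x + y, x + y] - ?W [x, x] - ?W [y, y] - (?W [x, y] + ?W [y, x])"
    by (simp add: fa_mul_add_left fa_mul_add_right fa_mul_diff_left fa_mul_diff_right fa_mul_word
        del: plus_fun_apply)
  finally have "(?W [x + y, x + y] - fa_smul (qV qA n (x + y)) (?W []))
      - (?W [x, x] - fa_smul (qV qA n x) (?W [])) - (?W [y, y] - fa_smul (qV qA n y) (?W []))
      - (?W [x + y, x + y] - ?W [x, x] - ?W [y, y] - (?W [x, y] + ?W [y, x])) \<in> ?I"
    by (rule fa.subspace_diff[OF sub fa.subspace_diff[OF sub fa.subspace_diff[OF sub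
      cl_ideal_square[OF add_in_Vset[OF x y]] cl_ideal_square[OF x]] cl_ideal_square[OF y]]])
  then show ?thesis
    by (simp add: qV_add fa.scale_left_distrib algebra_simps del: plus_fun_apply)
qed

subsection \<open>A basis of the quadratic module\<close>

text \<open>The basis joins a basis of \<open>A\<close> to the unit vectors of the two halves of
  H(R^n). Its last property is non-degeneracy of \<open>bV\<close> in coordinates: the Gram matrix
  has trivial kernel, without being invertible.\<close>

lemma vec_basis_ex:
  obtains e :: "nat \<Rightarrow> ('a, 'r) vec"
  where "\<And>i. e i \<in> Vset n"
    and "\<And>x. x \<in> Vset n \<Longrightarrow>
      fa_word [x] \<in> fa.span (cl_ideal emb qA n \<union> {fa_word [e i] | i. i < m + 2 * n})"
    and "\<And>r i. (\<And>v. v \<in> Vset n \<Longrightarrow> (\<Sum>i<m + 2 * n. r i * bV n v (e i)) = 0) \<Longrightarrow>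
      i < m + 2 * n \<Longrightarrow> r i = 0"
proof -
  obtain b where b_span: "\<And>x. \<exists>c. x = (\<Sum>i<m. emb (c i) * b i)"
    and b_indep: "\<And>c i. (\<Sum>i<m. emb (c i) * b i) = 0 \<Longrightarrow> i < m \<Longrightarrow> c i = 0"
    by (rule basis_ex; iprover)
  define \<delta> :: "nat \<Rightarrow> nat \<Rightarrow> 'r" where "\<delta> k = (\<lambda>j. if j = k then 1 else 0)" for k
  define e1 e2 e3 :: "nat \<Rightarrow> ('a, 'r) vec" where "e1 i = (b i, 0, 0)" and "e2 k = (0, \<delta> k, 0)"
    and "e3 k = (0, 0, \<delta> k)" for i k
  \<comment> \<open>The value 0 beyond the range keeps every \<open>e i\<close> in
    \<open>Vset n\<close>, with no bound on the index.\<close>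
  define e where "e i = (if i < m then e1 i else if i < m + n then e2 (i - m)
    else if i < m + 2 * n then e3 (i - m - n) else 0)" for i
  have split: "(\<Sum>i<m + 2 * n. f i) = (\<Sum>i<m. f i) + (\<Sum>k<n. f (m + k)) + (\<Sum>k<n. f (m + n + k))"
    for f :: "nat \<Rightarrow> 'r"
  proof -
    have "(\<Sum>i<p + q. f i) = (\<Sum>i<p. f i) + (\<Sum>k<q. f (p + k))" for p q
      by (induction q) (simp_all add: add.assoc)
    from this[of m "n + n"] this[of "m + n" n] this[of m n] show ?thesis
      by (simp add: mult_2 add.assoc)
  qed
  have e_simps: "i < m \<Longrightarrow> e i = e1 i" "k < n \<Longrightarrow> e (m + k) = e2 k" "k < n \<Longrightarrow> e (m + n + k) = e3 k" for i k
    by (simp_all add: e_def)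
  have in_V: "e i \<in> Vset n" for i
    using zero_in_Vset[of n, where ?'a = 'a and ?'b = 'r]
    by (auto simp: e_def e1_def e2_def e3_def \<delta>_def Vset_def)
  define S where "S = fa.span (cl_ideal emb qA n \<union> {fa_word [e i] | i. i < m + 2 * n})"
  \<comment> \<open>The vectors whose letter lies in the span. Linearity modulo the ideal makes this
    a submodule of V, so it suffices that it contains the basis.\<close>
  define A where "A = {x \<in> Vset n. fa_word [x] \<in> S}"
  have S: "fa.subspace S"
    unfolding S_def by (rule fa.subspace_span)
  have A_cong: "x \<in> A" if "x \<in> Vset n" "fa_word [x] - t \<in> cl_ideal emb qA n" "t \<in> S" for x t
  proof -
    have "fa_word [x] - t \<in> S"
      unfolding S_def using that by (intro fa.span_base) simp
    from fa.subspace_add[OF S this that(3)] that(1) show ?thesis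
      by (simp add: A_def)
  qed
  have A_add: "x + y \<in> A" if "x \<in> A" "y \<in> A" for x y
    using that A_cong[OF add_in_Vset cl_ideal_add] fa.subspace_add[OF S] by (auto simp: A_def)
  have A_smul: "vsmul emb r x \<in> A" if "x \<in> A" for r x
    using that A_cong[OF vsmul_in_Vset cl_ideal_smul] fa.subspace_scale[OF S] by (auto simp: A_def)
  have e_A: "e i \<in> A" if "i < m + 2 * n" for i
    using that in_V by (auto simp: A_def S_def intro!: fa.span_base)
  have A_zero: "0 \<in> A"
  proof -
    \<comment> \<open>The additivity relation for 0 + 0 is exactly the negative of the letter
      0.\<close>
    have "- fa_word [0] \<in> S"
      unfolding S_def using cl_ideal_add[OF zero_in_Vset zero_in_Vset, of n]
      by (intro fa.span_base) (simp del: plus_fun_apply)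
    from fa.subspace_neg[OF S this] show ?thesis
      by (simp add: A_def zero_in_Vset)
  qed
  have A_sum: "(\<Sum>i\<in>B. f i) \<in> A" if "\<And>i. i \<in> B \<Longrightarrow> f i \<in> A" for B :: "nat set" and f
    using that by (induction B rule: infinite_finite_induct) (simp_all add: A_zero A_add)
  have "x \<in> A" if "x \<in> Vset n" for x
  proof -
    obtain \<alpha> v w where x: "x = (\<alpha>, v, w)"
      by (cases x)
    obtain c where c: "\<alpha> = (\<Sum>i<m. emb (c i) * b i)"
      using b_span by blast
    have "x = (\<Sum>i<m. vsmul emb (c i) (e1 i)) + ((\<Sum>k<n. vsmul emb (v k) (e2 k)) + (\<Sum>k<n. vsmul emb (w k) (e3 k)))"
      using that
      by (auto simp: x c vsmul_def e1_def e2_def e3_def prod_eq_iff fst_sum snd_sum fun_eq_iff sum_fun_apply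
        \<delta>_def Vset_def if_distrib[of "(*) _"] cong: if_cong)
    also have "\<dots> \<in> A"
      by (intro A_add A_sum A_smul) (simp_all flip: e_simps add: e_A)
    finally show ?thesis .
  qed
  moreover have "r i = 0"
    if r: "\<And>v. v \<in> Vset n \<Longrightarrow> (\<Sum>i<m + 2 * n. r i * bV n v (e i)) = 0" and i: "i < m + 2 * n" for r i
  proof -
    have bV: "(\<Sum>i<m. r i * bV n v (e1 i)) + (\<Sum>k<n. r (m + k) * bV n v (e2 k))
        + (\<Sum>k<n. r (m + n + k) * bV n v (e3 k)) = 0" if "v \<in> Vset n" for v
      using r[OF that] by (simp add: split e_simps)
    \<comment> \<open>Test vectors from \<open>A\<close> isolate the first block of coefficients.
      For the hyperbolic part, \<open>e3 k\<close> isolates the coefficient of \<open>e2 k\<close>,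
      and conversely.\<close>
    have "polar \<beta> (\<Sum>i<m. emb (r i) * b i) = 0" for \<beta>
      using bV[of "(\<beta>, 0, 0)"]
      by (simp add: Vset_def bV_def e1_def e2_def e3_def polar_sum_right polar_smul_right)
    then have "(\<Sum>i<m. emb (r i) * b i) = 0"
      using polar_nondeg by (metis polarA_commute)
    then have 1: "r i = 0" if "i < m" for i
      using b_indep that by blast
    have 2: "r (m + k) = 0" if "k < n" for k
      using bV[of "e3 k"] that
      by (simp add: Vset_def bV_def e1_def e2_def e3_def \<delta>_def if_distrib[of "(*) _"] cong: if_cong)
    have 3: "r (m + n + k) = 0" if "k < n" for k
      using bV[of "e2 k"] that
      by (simp add: Vset_def bV_def e1_def e2_def e3_def \<delta>_def if_distrib[of "(*) _"] cong: if_cong)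
    show ?thesis
      using 1[of i] 2[of "i - m"] 3[of "i - m - n"] i by (cases "i < m"; cases "i < m + n") auto
  qed
  ultimately show ?thesis
    using in_V that[of e] unfolding A_def S_def by blast
qed
subsection \<open>A basis of the matrix algebra\<close>

text \<open>The basis consists of the matrices with a single nonzero entry, taken from a basis of
  \<open>A\<close>.\<close>

lemma matrices_free:
  obtains Ms :: "nat \<Rightarrow> 'a amat"
  where "\<And>i. Ms i \<in> Mset d"
    and "\<And>X. X \<in> Mset d \<Longrightarrow> \<exists>c. X = (\<Sum>i<m * (d * d). msmul (emb (c i)) (Ms i))"
    and "\<And>c i. (\<Sum>i<m * (d * d). msmul (emb (c i)) (Ms i)) = 0 \<Longrightarrow> i < m * (d * d) \<Longrightarrow> c i = 0"
proof -
  obtain b where b_span: "\<And>x. \<exists>c. x = (\<Sum>i<m. emb (c i) * b i)"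
    and b_indep: "\<And>c i. (\<Sum>i<m. emb (c i) * b i) = 0 \<Longrightarrow> i < m \<Longrightarrow> c i = 0"
    by (rule basis_ex; iprover)
  \<comment> \<open>Coordinates in \<open>A\<close> are chosen for all elements at once, so that
    they can be applied to every entry of a matrix.\<close>
  have "\<exists>C. \<forall>x. x = (\<Sum>p<m. emb (C x p) * b p)"
    by (intro choice allI b_span)
  then obtain C where C: "x = (\<Sum>p<m. emb (C x p) * b p)" for x
    by (elim exE) iprover
  \<comment> \<open>The index \<open>(k * d + l) * m + p\<close> encodes the position (k, l) and the
    basis element \<open>b p\<close>.\<close>
  define Ms where "Ms i = (\<lambda>k l. if k < d \<and> l < d \<and> i div m = k * d + l then b (i mod m) else 0)" for i
  have sum: "(\<Sum>i<m * (d * d). msmul (emb (c i)) (Ms i)) k l =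
      (\<Sum>p<m. emb (c ((k * d + l) * m + p)) * b p)" if "k < d" "l < d" for c k l
  proof -
    let ?a = "k * d + l"
    \<comment> \<open>The m consecutive indices belonging to the entry (k, l) stay below
      \<open>m * (d * d)\<close>.\<close>
    have "?a + 1 \<le> k * d + d" "k * d + d \<le> d * d"
      using that mult_le_mono1[of "Suc k" d d] by (simp_all add: add.commute)
    then have "(?a + 1) * m \<le> d * d * m"
      by (intro mult_le_mono1) linarith
    then have a: "?a * m + p < m * (d * d)" if "p < m" for p
      using that by (simp add: algebra_simps)
    have "(\<Sum>i<m * (d * d). msmul (emb (c i)) (Ms i)) k l =
        (\<Sum>i\<in>(\<lambda>p. ?a * m + p) ` {..<m}. emb (c i) * Ms i k l)"
      unfolding sum_fun_apply msmul_def
    proof (rule sum.mono_neutral_right)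
      show "\<forall>i\<in>{..<m * (d * d)} - (\<lambda>p. ?a * m + p) ` {..<m}. emb (c i) * Ms i k l = 0"
      proof
        fix i assume i: "i \<in> {..<m * (d * d)} - (\<lambda>p. ?a * m + p) ` {..<m}"
        then have "m > 0"
          by (cases m) auto
        have "i div m \<noteq> ?a"
        proof
          assume "i div m = ?a"
          then have "i = ?a * m + i mod m"
            using div_mult_mod_eq[of i m] by simp
          with i \<open>m > 0\<close> show False
            by (metis DiffD2 imageI lessThan_iff mod_less_divisor)
        qed
        then show "emb (c i) * Ms i k l = 0"
          by (simp add: Ms_def)
      qed
    qed (use a in auto)
    also have "\<dots> = (\<Sum>p<m. emb (c (?a * m + p)) * b p)"
      by (subst sum.reindex) (auto simp: inj_on_def Ms_def that intro!: sum.cong)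
    finally show ?thesis .
  qed
  have outside: "(\<Sum>i<m * (d * d). msmul (emb (c i)) (Ms i)) k l = 0" if "d \<le> k \<or> d \<le> l" for c k l
    using that by (auto simp: sum_fun_apply msmul_def Ms_def intro!: sum.neutral)
  show ?thesis
  proof (rule that)
    show "Ms i \<in> Mset d" for i
      by (auto simp: Ms_def Mset_def)
    show "\<exists>c. X = (\<Sum>i<m * (d * d). msmul (emb (c i)) (Ms i))" if X: "X \<in> Mset d" for X
    proof (intro exI ext)
      fix k l
      show "X k l = (\<Sum>i<m * (d * d). msmul (emb (C (X (i div m div d) (i div m mod d)) (i mod m))) (Ms i)) k l"
      proof (cases "k < d \<and> l < d")
        case True
        then show ?thesis
          using C[of "X k l"] by (simp add: sum)
      next
        case False
        then have "d \<le> k \<or> d \<le> l"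
          by auto
        with X show ?thesis
          by (simp only: outside) (auto simp: Mset_def)
      qed
    qed
    show "c i = 0" if c: "(\<Sum>i<m * (d * d). msmul (emb (c i)) (Ms i)) = 0" and i: "i < m * (d * d)" for c i
    proof -
      define k l p where "k = i div m div d" and "l = i div m mod d" and "p = i mod m"
      have "m > 0" "d > 0"
        using i by (auto intro: Nat.gr0I)
      then have "k < d" "l < d" "p < m"
        using i by (auto simp: k_def l_def p_def less_mult_imp_div_less mult.commute)
      moreover have "i = (k * d + l) * m + p"
        by (simp add: k_def l_def p_def)
      ultimately show ?thesis
        using b_indep[of "\<lambda>p. c ((k * d + l) * m + p)" p] sum[of k l c] c by simp
    qed
  qed
qed

end

text \<open>Collects what the argument needs of a basis of V: \<open>e_span\<close> gives spanning
  modulo the Clifford relations, and \<open>e_nondeg\<close> expresses non-degeneracy in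
  coordinates.\<close>

locale clifford_basis = composition emb qA m
  for emb :: "'r::comm_ring_1 \<Rightarrow> 'a::ring_1" and qA :: "'a \<Rightarrow> 'r" and m :: nat +
  fixes n M :: nat and e :: "nat \<Rightarrow> ('a, 'r) vec"
  assumes e_in_Vset: "e i \<in> Vset n"
    and e_span: "x \<in> Vset n \<Longrightarrow> fa_word [x] \<in> fa.span (cl_ideal emb qA n \<union> {fa_word [e i] | i. i < M})"
    and e_nondeg: "(\<And>v. v \<in> Vset n \<Longrightarrow> (\<Sum>i<M. r i * bV n v (e i)) = 0) \<Longrightarrow> i < M \<Longrightarrow> r i = 0"
begin

subsection \<open>Monomials in the basis span the Clifford algebra\<close>

definition monom :: "nat set \<Rightarrow> ('a, 'r) vec list" where
  "monom S = map e (sorted_list_of_set S)"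

lemma monom_empty: "monom {} = []"
  by (simp add: monom_def)

lemma monom_insert:
  assumes "finite A" "\<And>a. a \<in> A \<Longrightarrow> j < a"
  shows "monom (insert j A) = e j # monom A"
proof -
  have "sorted_list_of_set (insert j A) = j # sorted_list_of_set A"
    using assms by (rule sorted_list_of_set_insert_less)
  then show ?thesis
    by (simp only: monom_def list.map)
qed

lemma set_monom_subset: "set (monom S) \<subseteq> Vset n"
  using e_in_Vset by (auto simp: monom_def)

abbreviation "I \<equiv> cl_ideal emb qA n"

text \<open>The ideal is included, so membership means being a combination of monomials modulo the
  Clifford relations. The lower bound k on the indices serves the reordering induction in
  \<open>monom_span_Cons\<close>.\<close>

definition monom_span :: "nat \<Rightarrow> (('a, 'r) vec list \<Rightarrow> 'r) set" where
  "monom_span k = fa.span (I \<union> {fa_word (monom S) | S. S \<subseteq> {k..<M}})"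

lemma subspace_monom_span: "fa.subspace (monom_span k)"
  unfolding monom_span_def by (rule fa.subspace_span)

lemma ideal_subset_monom_span: "t \<in> I \<Longrightarrow> t \<in> monom_span k"
  unfolding monom_span_def by (rule fa.span_base) simp

lemma monom_in_span: "S \<subseteq> {k..<M} \<Longrightarrow> fa_word (monom S) \<in> monom_span k"
  unfolding monom_span_def by (rule fa.span_base) blast

lemma monom_span_cong:
  assumes "s - t \<in> I" "t \<in> monom_span k"
  shows "s \<in> monom_span k"
  using fa.subspace_add[OF subspace_monom_span ideal_subset_monom_span[OF assms(1)] assms(2)]
  by simp

text \<open>Left multiplication is linear and preserves the ideal, so only monomials need to be
  checked.\<close>

lemma monom_span_mult:
  assumes "\<And>S. S \<subseteq> {k..<M} \<Longrightarrow> fa_word (x # monom S) \<in> monom_span l" "x \<in> Vset n" "t \<in> monom_span k"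
  shows "fa_mul (fa_word [x]) t \<in> monom_span l"
  using assms(3) unfolding monom_span_def[of k]
proof (induction t rule: fa.span_induct)
  case base
  show ?case
    using subspace_monom_span[of l] unfolding fa.subspace_def
    by (auto simp: fa_mul_zero_right fa_mul_add_right fa_mul_smul_right
        simp del: zero_fun_apply plus_fun_apply)
next
  case (step t)
  then consider "t \<in> I" | S where "S \<subseteq> {k..<M}" "t = fa_word (monom S)"
    by blast
  then show ?case
  proof cases
    case 1
    then show ?thesis
      using assms(2) by (intro ideal_subset_monom_span cl_ideal_lmul fa_elem_word) simp_all
  next
    case 2
    then show ?thesis
      using assms(1) by (simp add: fa_mul_word)
  qed
qed

text \<open>All indices in \<open>t\<close> exceed j, so putting \<open>e j\<close> in front gives
  monomials that are already ordered.\<close>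

lemma monom_span_mult_smaller:
  assumes "j < M" "t \<in> monom_span (Suc j)" "k \<le> j"
  shows "fa_mul (fa_word [e j]) t \<in> monom_span k"
proof (rule monom_span_mult[OF _ e_in_Vset assms(2)])
  fix S assume S: "S \<subseteq> {Suc j..<M}"
  then have "e j # monom S = monom (insert j S)"
    by (subst monom_insert) (auto intro: finite_subset)
  moreover have "insert j S \<subseteq> {k..<M}"
    using S assms by auto
  ultimately show "fa_word (e j # monom S) \<in> monom_span k"
    using monom_in_span by metis
qed

text \<open>The new letter is compared with the least index j of the monomial: it is already in
  place, it is removed by the square relation, or it is moved past \<open>e j\<close> by the
  anticommutation relation. The bound k stays arbitrary because the last case uses the hypothesis
  for \<open>Suc j\<close>.\<close>

lemma monom_span_Cons:
  assumes "finite S" "S \<subseteq> {k..<M}" "k \<le> i" "i < M"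
  shows "fa_word (e i # monom S) \<in> monom_span k"
  using assms
proof (induction S arbitrary: k rule: finite_linorder_min_induct)
  case empty
  then show ?case
    using monom_in_span[of "{i}" k] by (simp add: monom_def)
next
  case (insert j S)
  have j: "k \<le> j" "j < M" and S: "S \<subseteq> {Suc j..<M}" "S \<subseteq> {k..<M}"
    using insert.hyps(2) insert.prems(1) by (auto simp: Suc_le_eq)
  have mono_j: "monom (insert j S) = e j # monom S"
    using insert by (simp add: monom_insert)
  note sub = subspace_monom_span[of k]
  have word: "fa_elem (Vset n) (fa_word (monom S) :: ('a, 'r) vec list \<Rightarrow> 'r)"
    by (rule fa_elem_word[OF set_monom_subset])
  consider "i < j" | "i = j" | "j < i"
    by linarith
  then show ?case
  proof cases
    case 1
    then have "monom (insert i (insert j S)) = e i # monom (insert j S)"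
      using insert by (subst monom_insert) auto
    moreover have "insert i (insert j S) \<subseteq> {k..<M}"
      using insert by auto
    ultimately show ?thesis
      using monom_in_span by metis
  next
    case 2
    have "fa_mul (fa_word [e i, e i] - fa_smul (qV qA n (e i)) (fa_word [])) (fa_word (monom S)) \<in> I"
      using cl_ideal_square[OF e_in_Vset] word by (rule cl_ideal_rmul)
    then have "fa_word (e i # e i # monom S) - fa_smul (qV qA n (e i)) (fa_word (monom S)) \<in> I"
      by (simp add: fa_mul_diff_left fa_mul_smul_left fa_mul_word)
    then show ?thesis
      unfolding mono_j 2
      by (rule monom_span_cong) (intro fa.subspace_scale[OF sub] monom_in_span S)
  next
    case 3
    have "fa_mul (fa_word [e i, e j] + fa_word [e j, e i] - fa_smul (bV n (e i) (e j)) (fa_word []))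
        (fa_word (monom S)) \<in> I"
      using cl_ideal_anticommute[OF e_in_Vset e_in_Vset] word by (rule cl_ideal_rmul)
    then have "fa_word (e i # e j # monom S) -
        (fa_smul (bV n (e i) (e j)) (fa_word (monom S)) - fa_word (e j # e i # monom S)) \<in> I"
      by (simp add: fa_mul_add_left fa_mul_diff_left fa_mul_smul_left fa_mul_word algebra_simps
          del: plus_fun_apply)
    \<comment> \<open>As j < i, the induction hypothesis orders \<open>e i # monom S\<close> using
      only indices above j; then \<open>e j\<close> can be put in front.\<close>
    moreover have "fa_mul (fa_word [e j]) (fa_word (e i # monom S)) \<in> monom_span k"
      using j 3 S insert.prems by (intro monom_span_mult_smaller insert.IH) auto
    then have "fa_word (e j # e i # monom S) \<in> monom_span k"
      by (simp add: fa_mul_word)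
    ultimately show ?thesis
      unfolding mono_j
      by (elim monom_span_cong)
        (intro fa.subspace_diff[OF sub] fa.subspace_scale[OF sub] monom_in_span S)
  qed
qed

text \<open>With the monomial fixed, the product is linear in its left factor, which by
  \<open>e_span\<close> may be replaced by basis letters.\<close>

lemma monom_span_left_mult:
  assumes "x \<in> Vset n" "t \<in> monom_span 0"
  shows "fa_mul (fa_word [x]) t \<in> monom_span 0"
proof (rule monom_span_mult[OF _ assms])
  fix S assume S: "S \<subseteq> {0..<M}"
  have "fa_mul s (fa_word (monom S)) \<in> monom_span 0"
    if "s \<in> fa.span (I \<union> {fa_word [e i] | i. i < M})" for s
    using that
  proof (induction s rule: fa.span_induct)
    case base
    show ?case
      using subspace_monom_span[of 0] unfolding fa.subspace_def
      by (auto simp: fa_mul_zero_left fa_mul_add_left fa_mul_smul_left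
          simp del: zero_fun_apply plus_fun_apply)
  next
    case (step s)
    then consider "s \<in> I" | i where "i < M" "s = fa_word [e i]"
      by blast
    then show ?case
    proof cases
      case 1
      then show ?thesis
        by (intro ideal_subset_monom_span cl_ideal_rmul fa_elem_word set_monom_subset)
    next
      case 2
      then show ?thesis
        using S finite_subset[OF S] by (simp add: fa_mul_word monom_span_Cons)
    qed
  qed
  from this[OF e_span[OF assms(1)]] show "fa_word (x # monom S) \<in> monom_span 0"
    by (simp add: fa_mul_word)
qed

lemma monom_span_all:
  assumes "fa_elem (Vset n) t"
  shows "t \<in> monom_span 0"
  using assms
proof (induction t rule: fa_elem_induct)
  case (word u)
  then show ?case
  proof (induction u)
    case Nil
    show ?case
      using monom_in_span[of "{}" 0] by (simp add: monom_empty)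
  next
    case (Cons x u)
    then show ?case
      using monom_span_left_mult[of x "fa_word u"] by (simp add: fa_mul_word)
  qed
qed (use subspace_monom_span[of 0] in \<open>simp_all add: fa.subspace_def del: zero_fun_apply plus_fun_apply\<close>)

text \<open>Turns membership in the span into explicit coefficients indexed by all subsets: elements
  admitting such coefficients form a submodule containing the ideal and the monomials.\<close>

lemma monomials_span:
  assumes "fa_elem (Vset n) t"
  obtains c where "t - (\<Sum>S\<in>Pow {..<M}. fa_smul (c S) (fa_word (monom S))) \<in> I"
proof -
  let ?f = "\<lambda>c. \<Sum>S\<in>Pow {..<M}. fa_smul (c S) (fa_word (monom S)) :: ('a, 'r) vec list \<Rightarrow> 'r"
  note sub = subspace_cl_ideal[of n]
  have add: "?f (\<lambda>S. c S + d S) = ?f c + ?f d" for c d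
    by (simp add: fa.scale_left_distrib sum.distrib del: plus_fun_apply)
  have smul: "?f (\<lambda>S. r * c S) = fa_smul r (?f c)" for r c
    by (simp add: fa.scale_sum_right)
  have zero: "?f (\<lambda>_. 0) = 0"
    by simp
  have "t \<in> fa.span (I \<union> {fa_word (monom S) | S. S \<subseteq> {0..<M}})"
    using monom_span_all[OF assms] by (simp add: monom_span_def)
  then have "\<exists>c. t - ?f c \<in> I"
  proof (induction t rule: fa.span_induct)
    case base
    show ?case
    proof (rule fa.subspaceI; safe)
      show "\<exists>c. 0 - ?f c \<in> I"
        using zero fa.subspace_0[OF sub] by (intro exI[of _ "\<lambda>_. 0"]) simp
      show "\<exists>c. s + t - ?f c \<in> I" if "s - ?f c \<in> I" "t - ?f d \<in> I" for s t c d
      proof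
        have "s + t - ?f (\<lambda>S. c S + d S) = (s - ?f c) + (t - ?f d)"
          by (simp only: add diff_conv_add_uminus minus_add_distrib add_ac)
        then show "s + t - ?f (\<lambda>S. c S + d S) \<in> I"
          using fa.subspace_add[OF sub that] by (simp only:)
      qed
      show "\<exists>c. fa_smul r t - ?f c \<in> I" if "t - ?f c \<in> I" for r t c
        using fa.subspace_scale[OF sub that, of r]
        by (intro exI[of _ "\<lambda>S. r * c S"]) (simp only: smul fa.scale_right_diff_distrib)
    qed
  next
    case (step t)
    then consider "t \<in> I" | S where "S \<subseteq> {..<M}" "t = fa_word (monom S)"
      by (auto simp: lessThan_atLeast0)
    then show ?case
    proof cases
      case 1
      then show ?thesis
        using zero by (intro exI[of _ "\<lambda>_. 0"]) simp
    next
      case 2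
      have "?f (\<lambda>T. if T = S then 1 else 0) = (\<Sum>T\<in>Pow {..<M}. if T = S then fa_word (monom S) else 0)"
        by (intro sum.cong) auto
      then have "t - ?f (\<lambda>T. if T = S then 1 else 0) = 0"
        using 2 by simp
      then show ?thesis
        using fa.subspace_0[OF sub] by (intro exI[of _ "\<lambda>T. if T = S then 1 else 0"]) (simp only:)
    qed
  qed
  with that show ?thesis
    by blast
qed

subsection \<open>Images of the monomials are independent\<close>

text \<open>The sign collected by a twisted derivation on its way past the factors of the monomial
  that precede \<open>e i\<close>.\<close>

definition sign :: "nat \<Rightarrow> nat set \<Rightarrow> 'r" where
  "sign i S = (- 1) ^ card {j \<in> S. j < i}"

lemma sign_square: "sign i S * sign i S = 1"
  by (simp add: sign_def flip: power_add mult_2)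

abbreviation "E S \<equiv> phi_word emb qA n (monom S)"

text \<open>The Leibniz rule applied along the monomial, one factor at a time from the
  front.\<close>

lemma der_E:
  assumes "finite S"
  shows "der n v (E S) = (\<Sum>i\<in>S. msmul (emb (sign i S * bV n v (e i))) (E (S - {i})))"
  using assms
proof (induction S rule: finite_linorder_min_induct)
  case empty
  show ?case
    by (simp add: monom_empty phi_word_Nil der_one del: power_Suc zero_fun_apply)
next
  case (insert j A)
  let ?m = "mmul (2 ^ Suc n)"
  have j: "j \<notin> A"
    using insert by blast
  have E_insert: "E (insert j B) = ?m (Phi emb qA n (e j)) (E B)" if "B \<subseteq> A" for B
    using insert that by (subst monom_insert) (auto intro: finite_subset simp: phi_word_Cons)
  have "{k \<in> insert j A. k < j} = {}"
    using insert by auto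
  then have sign_j: "sign j (insert j A) = 1"
    unfolding sign_def by (simp only: card.empty power_0)
  \<comment> \<open>The least index j precedes every i in \<open>A\<close>, which adds one
    transposition and matches the minus sign of the Leibniz rule.\<close>
  have sign_i: "sign i (insert j A) = - sign i A" if "i \<in> A" for i
  proof -
    have "{k \<in> insert j A. k < i} = insert j {k \<in> A. k < i}"
      using that insert by auto
    then have "card {k \<in> insert j A. k < i} = Suc (card {k \<in> A. k < i})"
      using insert.hyps(1) j by (simp only:) simp
    then show ?thesis
      unfolding sign_def by (simp only: power_Suc mult_minus1)
  qed
  have "der n v (E (insert j A)) = msmul (emb (bV n v (e j))) (E A)
      - ?m (Phi emb qA n (e j)) (der n v (E A))"
    using E_insert[of A] by (simp add: der_Phi_mult phi_word_in_Mset del: power_Suc)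
  also have "?m (Phi emb qA n (e j)) (der n v (E A)) =
      (\<Sum>i\<in>A. msmul (emb (sign i A * bV n v (e i))) (?m (Phi emb qA n (e j)) (E (A - {i}))))"
    by (simp add: insert.IH mmul_sum_right mmul_msmul_right[OF emb_central] del: power_Suc)
  also have "\<dots> = - (\<Sum>i\<in>A. msmul (emb (sign i (insert j A) * bV n v (e i))) (E (insert j A - {i})))"
  proof (subst sum_negf[symmetric], rule sum.cong[OF refl])
    fix i assume i: "i \<in> A"
    then have "insert j A - {i} = insert j (A - {i})"
      using j by auto
    then show "msmul (emb (sign i A * bV n v (e i))) (?m (Phi emb qA n (e j)) (E (A - {i}))) =
        - msmul (emb (sign i (insert j A) * bV n v (e i))) (E (insert j A - {i}))"
      using i by (simp add: sign_i E_insert emb_minus msmul_minus_left del: power_Suc)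
  qed
  finally have "der n v (E (insert j A)) = msmul (emb (bV n v (e j))) (E A) +
      (\<Sum>i\<in>A. msmul (emb (sign i (insert j A) * bV n v (e i))) (E (insert j A - {i})))"
    by (simp only: diff_minus_eq_add)
  then show ?case
    using insert.hyps(1) j by (simp add: sign_j del: plus_fun_apply)
qed

lemma E_independent:
  assumes "(\<Sum>S\<in>Pow {..<M}. msmul (emb (c S)) (E S)) = 0" "S \<subseteq> {..<M}"
  shows "c S = 0"
proof -
  \<comment> \<open>Here k strictly bounds the degree of the relation. The coefficients stay
    arbitrary because the induction hypothesis is applied to those of a derived relation.\<close>
  have main: "\<forall>S\<subseteq>{..<M}. c S = 0"
    if "\<forall>S\<subseteq>{..<M}. k \<le> card S \<longrightarrow> c S = 0" "(\<Sum>S\<in>Pow {..<M}. msmul (emb (c S)) (E S)) = 0" for k c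
    using that
  proof (induction k arbitrary: c)
    case 0
    then show ?case
      by simp
  next
    case (Suc k)
    have fin: "finite S" if "S \<subseteq> {..<M}" for S
      using that by (rule finite_subset) simp
    \<comment> \<open>The coefficient of \<open>E T\<close> in the derived relation:
      \<open>E T\<close> arises by deleting i from \<open>insert i T\<close>.\<close>
    define d where "d v T = (\<Sum>i\<in>{..<M} - T. c (insert i T) * sign i (insert i T) * bV n v (e i))" for v T
    have d_zero: "d v T = 0" if T: "T \<subseteq> {..<M}" for v T
    proof -
      have "0 = der n v (\<Sum>S\<in>Pow {..<M}. msmul (emb (c S)) (E S))"
        by (simp only: Suc.prems der_zero)
      also have "\<dots> = (\<Sum>S\<in>Pow {..<M}. \<Sum>i\<in>S. msmul (emb (c S * (sign i S * bV n v (e i)))) (E (S - {i})))"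
        by (simp add: der_sum der_msmul der_E fin msmul_sum_right msmul_msmul emb_mult)
      also have "\<dots> = (\<Sum>(S, i)\<in>Sigma (Pow {..<M}) (\<lambda>S. S).
          msmul (emb (c S * (sign i S * bV n v (e i)))) (E (S - {i})))"
        by (rule sum.Sigma) (auto intro: fin)
      also have "\<dots> = (\<Sum>(T, i)\<in>Sigma (Pow {..<M}) (\<lambda>T. {..<M} - T).
          msmul (emb (c (insert i T) * sign i (insert i T) * bV n v (e i))) (E T))"
        \<comment> \<open>Pairs of a set and a member i correspond to pairs of a set and a
          non-member i, by deleting and inserting i.\<close>
        by (rule sum.reindex_bij_witness[where j = "\<lambda>(S, i). (S - {i}, i)" and i = "\<lambda>(T, i). (insert i T, i)"])
          (auto simp: insert_absorb mult.assoc)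
      also have "\<dots> = (\<Sum>T\<in>Pow {..<M}. \<Sum>i\<in>{..<M} - T.
          msmul (emb (c (insert i T) * sign i (insert i T) * bV n v (e i))) (E T))"
        by (rule sum.Sigma[symmetric]) auto
      also have "\<dots> = (\<Sum>T\<in>Pow {..<M}. msmul (emb (d v T)) (E T))"
        by (simp add: d_def msmul_def fun_eq_iff sum_fun_apply sum_distrib_right emb_sum)
      finally have "(\<Sum>T\<in>Pow {..<M}. msmul (emb (d v T)) (E T)) = 0" ..
      moreover have "d v T = 0" if "T \<subseteq> {..<M}" "k \<le> card T" for T
        unfolding d_def
      proof (rule sum.neutral, rule ballI)
        fix i assume i: "i \<in> {..<M} - T"
        then have "c (insert i T) = 0"
          using Suc.prems(1) that fin[OF that(1)] by simp
        then show "c (insert i T) * sign i (insert i T) * bV n v (e i) = 0"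
          by simp
      qed
      ultimately show ?thesis
        using Suc.IH[of "d v"] T by simp
    qed
    have c_insert: "c (insert i T) = 0" if "T \<subseteq> {..<M}" "i < M" "i \<notin> T" for i T
    proof -
      \<comment> \<open>Extension by zero on \<open>T\<close> turns the sum over the complement into
        one over all indices, the form that \<open>e_nondeg\<close> takes.\<close>
      define r where "r i = (if i \<in> T then 0 else c (insert i T) * sign i (insert i T))" for i
      have "(\<Sum>i<M. r i * bV n v (e i)) = d v T" for v
        unfolding d_def by (rule sum.mono_neutral_cong_right) (auto simp: r_def)
      then have "r i = 0"
        using d_zero[OF that(1)] e_nondeg[of r i] that(2) by simp
      \<comment> \<open>A second factor \<open>sign i (insert i T)\<close> removes the first,
        because signs square to 1.\<close>
      then have "c (insert i T) * (sign i (insert i T) * sign i (insert i T)) = 0"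
        using that(3) by (simp add: r_def flip: mult.assoc)
      then show ?thesis
        by (simp add: sign_square)
    qed
    have nonempty: "c S = 0" if "S \<subseteq> {..<M}" "S \<noteq> {}" for S
    proof -
      from that obtain i where "i \<in> S" "i < M"
        by blast
      with that show ?thesis
        using c_insert[of "S - {i}" i] by (auto simp: insert_absorb)
    qed
    have "(\<Sum>S\<in>Pow {..<M}. msmul (emb (c S)) (E S)) = (\<Sum>S\<in>{{}}. msmul (emb (c S)) (E S))"
      by (rule sum.mono_neutral_right) (use nonempty in \<open>auto simp: msmul_zero_left\<close>)
    then have "msmul (emb (c {})) (E {}) = 0"
      unfolding Suc.prems(2) by (simp del: zero_fun_apply)
    \<comment> \<open>\<open>E {}\<close> is the identity matrix, so its entry at (0, 0) exposes the
      remaining coefficient.\<close>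
    then have "msmul (emb (c {})) (E {}) 0 0 = 0"
      by simp
    then have "emb (c {}) = 0"
      by (simp add: monom_empty phi_word_Nil msmul_def scal_def)
    then have "c {} = 0"
      by (simp add: emb_eq_zero_iff)
    with nonempty show ?case
      by metis
  qed
  \<comment> \<open>The degree bound \<open>Suc M\<close> holds for every relation, which starts the
    induction.\<close>
  have "\<not> Suc M \<le> card T" if "T \<subseteq> {..<M}" for T
    using card_mono[OF _ that] by simp
  with main[OF _ assms(1), of "Suc M"] assms(2) show ?thesis
    by blast
qed

section \<open>Injectivity and freeness of the Clifford algebra\<close>

lemma phi_ext_monomials:
  "\<phi> n (\<Sum>S\<in>A. fa_smul (c S) (fa_word (monom S))) = (\<Sum>S\<in>A. msmul (emb (c S)) (E S))"
  by (subst phi_ext_sum[of _ "Vset n"]) (simp_all add: fa_elem_word set_monom_subset phi_ext_word)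

text \<open>Modulo the ideal, \<open>t\<close> is a combination of monomials with the same image. If
  that image is 0, independence of the \<open>E S\<close> makes all coefficients vanish, so
  \<open>t\<close> itself lies in the ideal.\<close>

lemma phi_ext_eq_zero_iff:
  assumes "fa_elem (Vset n) t"
  shows "\<phi> n t = 0 \<longleftrightarrow> t \<in> I"
proof
  assume t: "\<phi> n t = 0"
  obtain c where c: "t - (\<Sum>S\<in>Pow {..<M}. fa_smul (c S) (fa_word (monom S))) \<in> I"
    using monomials_span[OF assms] .
  let ?s = "\<Sum>S\<in>Pow {..<M}. fa_smul (c S) (fa_word (monom S))"
  have s: "fa_elem (Vset n) ?s"
    using fa.subspace_sum[OF subspace_fa_elem, of "Pow {..<M}" "\<lambda>S. fa_smul (c S) (fa_word (monom S))" "Vset n"]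
    by (simp add: fa_elem_smul fa_elem_word set_monom_subset)
  have "\<phi> n t - \<phi> n ?s = 0"
    using phi_ext_cl_ideal[OF c] phi_ext_diff[OF assms s] by simp
  then have "c S = 0" if "S \<subseteq> {..<M}" for S
    using E_independent[OF _ that] t by (simp add: phi_ext_monomials)
  then have "?s = 0"
    by (intro sum.neutral) simp
  with c show "t \<in> I"
    by simp
qed (rule phi_ext_cl_ideal)

text \<open>A relation in Cl(V) is carried by \<open>phi_ext\<close> to a relation between
  matrices.\<close>

lemma monomials_independent:
  assumes "(\<Sum>S\<in>Pow {..<M}. fa_smul (c S) (fa_word (monom S))) \<in> I" "S \<subseteq> {..<M}"
  shows "c S = 0"
  using phi_ext_cl_ideal[OF assms(1)] assms(2) unfolding phi_ext_monomials by (rule E_independent)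

lemma clifford_free:
  obtains bs :: "nat \<Rightarrow> ('a, 'r) vec list \<Rightarrow> 'r"
  where "\<And>i. fa_elem (Vset n) (bs i)"
    and "\<And>t. fa_elem (Vset n) t \<Longrightarrow> \<exists>c. t - (\<Sum>i<2 ^ M. fa_smul (c i) (bs i)) \<in> I"
    and "\<And>c i. (\<Sum>i<2 ^ M. fa_smul (c i) (bs i)) \<in> I \<Longrightarrow> i < 2 ^ M \<Longrightarrow> c i = 0"
proof -
  obtain h where h: "bij_betw h {..<(2::nat) ^ M} (Pow {..<M})"
    using ex_bij_betw_nat_finite[of "Pow {..<M}"] by (auto simp: card_Pow lessThan_atLeast0)
  \<comment> \<open>The inverse enumeration turns coefficients indexed by numbers into coefficients
    indexed by subsets.\<close>
  define g where "g = inv_into {..<2 ^ M} h"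
  have g: "bij_betw g (Pow {..<M}) {..<2 ^ M}" "\<And>i. i < 2 ^ M \<Longrightarrow> g (h i) = i"
    using h by (simp_all add: g_def bij_betw_inv_into bij_betw_inv_into_left)
  have h_in: "h i \<subseteq> {..<M}" if "i < 2 ^ M" for i
    using bij_betwE[OF h] that by blast
  define bs :: "nat \<Rightarrow> ('a, 'r) vec list \<Rightarrow> 'r" where "bs i = fa_word (monom (h i))" for i
  have eq: "(\<Sum>i<2 ^ M. fa_smul (c (h i)) (bs i)) = (\<Sum>S\<in>Pow {..<M}. fa_smul (c S) (fa_word (monom S)))" for c
    unfolding bs_def using h by (rule sum.reindex_bij_betw)
  show ?thesis
  proof (rule that)
    show "fa_elem (Vset n) (bs i)" for i
      by (simp add: bs_def fa_elem_word set_monom_subset)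
    show "\<exists>c. t - (\<Sum>i<2 ^ M. fa_smul (c i) (bs i)) \<in> I" if t: "fa_elem (Vset n) t" for t
    proof -
      obtain c where "t - (\<Sum>S\<in>Pow {..<M}. fa_smul (c S) (fa_word (monom S))) \<in> I"
        using monomials_span[OF t] .
      then show ?thesis
        by (intro exI[of _ "\<lambda>i. c (h i)"]) (simp only: eq)
    qed
    show "c i = 0" if "(\<Sum>i<2 ^ M. fa_smul (c i) (bs i)) \<in> I" "i < 2 ^ M" for c i
    proof -
      have "(\<Sum>i<2 ^ M. fa_smul (c i) (bs i)) = (\<Sum>i<2 ^ M. fa_smul (c (g (h i))) (bs i))"
        by (intro sum.cong) (simp_all add: g)
      then have "c (g (h i)) = 0"
        using that eq[of "\<lambda>S. c (g S)"] monomials_independent[of "\<lambda>S. c (g S)"] h_in by simp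
      then show ?thesis
        using that(2) by (simp add: g)
    qed
  qed
qed

end

theorem theorem9p1:
  fixes emb :: "'r::comm_ring_1 \<Rightarrow> 'a::ring_1" and qA :: "'a \<Rightarrow> 'r" and n :: nat
  assumes "quaternion_algebra emb qA"
    and "1 \<le> n"
  shows "(\<forall>t. fa_elem (Vset n) t \<longrightarrow>
            (phi_ext emb qA n t = (\<lambda>_ _. 0) \<longleftrightarrow> t \<in> cl_ideal emb qA n))
       \<and> (\<exists>(N::nat) (bs :: nat \<Rightarrow> ('a, 'r) vec list \<Rightarrow> 'r) (Ms :: nat \<Rightarrow> 'a amat).
            (\<forall>i<N. fa_elem (Vset n) (bs i))
          \<and> (\<forall>t. fa_elem (Vset n) t \<longrightarrow>
                (\<exists>c. fa_diff t (\<lambda>u. \<Sum>i<N. c i * bs i u) \<in> cl_ideal emb qA n))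
          \<and> (\<forall>c. (\<lambda>u. \<Sum>i<N. c i * bs i u) \<in> cl_ideal emb qA n \<longrightarrow> (\<forall>i<N. c i = 0))
          \<and> (\<forall>i<N. Ms i \<in> Mset (2 ^ Suc n))
          \<and> (\<forall>X\<in>Mset (2 ^ Suc n). \<exists>c. X = (\<lambda>k l. \<Sum>i<N. emb (c i) * Ms i k l))
          \<and> (\<forall>c. (\<lambda>k l. \<Sum>i<N. emb (c i) * Ms i k l) = (\<lambda>_ _. 0) \<longrightarrow> (\<forall>i<N. c i = 0)))"
proof -
  interpret composition emb qA 4
    using assms(1) by unfold_locales (simp add: quaternion_algebra_def)
  let ?N = "(2::nat) ^ (4 + 2 * n)"
  obtain e where e: "\<And>i. e i \<in> Vset n"
    "\<And>x. x \<in> Vset n \<Longrightarrow>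
      fa_word [x] \<in> fa.span (cl_ideal emb qA n \<union> {fa_word [e i] | i. i < 4 + 2 * n})"
    "\<And>r i. (\<And>v. v \<in> Vset n \<Longrightarrow> (\<Sum>i<4 + 2 * n. r i * bV n v (e i)) = 0) \<Longrightarrow>
      i < 4 + 2 * n \<Longrightarrow> r i = 0"
    by (rule vec_basis_ex[of n]; iprover)
  interpret clifford_basis emb qA 4 n "4 + 2 * n" e
    by unfold_locales (fact e)+
  obtain bs where bs: "\<And>i. fa_elem (Vset n) (bs i)"
    "\<And>t. fa_elem (Vset n) t \<Longrightarrow> \<exists>c. t - (\<Sum>i<?N. fa_smul (c i) (bs i)) \<in> I"
    "\<And>c i. (\<Sum>i<?N. fa_smul (c i) (bs i)) \<in> I \<Longrightarrow> i < ?N \<Longrightarrow> c i = 0"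
    by (rule clifford_free; iprover)
  \<comment> \<open>Equality of the ranks: 4 times the square of the matrix size
    \<open>2 ^ Suc n\<close> is the number of subsets of a basis of V, which has
    \<open>4 + 2 * n\<close> elements.\<close>
  have N: "4 * (2 ^ Suc n * 2 ^ Suc n) = ?N"
  proof -
    have "?N = 2\<^sup>2 * (2 ^ Suc n * 2 ^ Suc n)"
      unfolding power_add[symmetric] by (rule arg_cong) simp
    then show ?thesis
      by (simp only: power2_eq_square)
  qed
  obtain Ms where Ms: "\<And>i. Ms i \<in> Mset (2 ^ Suc n)"
    "\<And>X. X \<in> Mset (2 ^ Suc n) \<Longrightarrow> \<exists>c. X = (\<Sum>i<?N. msmul (emb (c i)) (Ms i))"
    "\<And>c i. (\<Sum>i<?N. msmul (emb (c i)) (Ms i)) = 0 \<Longrightarrow> i < ?N \<Longrightarrow> c i = 0"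
    by (rule matrices_free[of "2 ^ Suc n", unfolded N]; iprover)
  have fa_sum: "(\<lambda>u. \<Sum>i<?N. c i * bs i u) = (\<Sum>i<?N. fa_smul (c i) (bs i))" for c
    by (simp add: fun_eq_iff sum_fun_apply fa_smul_def)
  have mat_sum: "(\<lambda>k l. \<Sum>i<?N. emb (c i) * Ms i k l) = (\<Sum>i<?N. msmul (emb (c i)) (Ms i))" for c
    by (simp add: fun_eq_iff sum_fun_apply msmul_def)
  have zero: "(\<lambda>_ _. 0) = (0 :: 'a amat)"
    by (simp add: zero_fun_def)
  show ?thesis
    unfolding zero
    by (intro conjI exI[of _ ?N] exI[of _ bs] exI[of _ Ms] allI impI ballI, unfold fa_sum mat_sum fa_diff_eq)
      ((rule phi_ext_eq_zero_iff bs Ms; assumption)+)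
qed

end
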